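(* Let $1\le k\le d$ and let $q$ be odd. If $E\subseteq\mathbb{F}_q^d$ is $(4,s)$-Salem, then \[ \#T_k^d(E)\gtrsim\min\Big\{q^{\binom{k+1}{2}},\ (\#E)^{k-1+4s}q^{\binom{k+1}{2}-kd}\Big\}. \] In particular, if $\#E\gtrsim q^{\frac{kd}{k+1}}$ and $E$ is $(4,1/2)$-Salem, then $\#T_k^d(E)\gtrsim q^{\binom{k+1}{2}}$.
   Context: $q$ is a prime power, $\chi$ a fixed non-trivial additive character of $\mathbb{F}_q$. $\widehat E(x)=q^{-d}\sum_{y\in E}\chi(-x\cdot y)$, $\|\widehat E\|_4=\big(q^{-d}\sum_{x\ne0}|\widehat E(x)|^4\big)^{1/4}$. Sets are families indexed by $q$; $A\lesssim B$ means $A\le cB$ with $c$ independent of $q$. $E$ is $(4,s)$-Salem if $\|\widehat E\|_4\lesssim q^{-d}(\#E)^{1-s}$. A $k$-simplex in $E$ is given by its vertices $(x_1,\dots,x_{k+1})\in E^{k+1}$; two $k$-simplices $(x_1,\dots,x_{k+1})$ and $(y_1,\dots,y_{k+1})$ are congruent if there is a rigid motion $A\in\mathbb{F}_q^d\rtimes O_d(\mathbb{F}_q)$ (a map $x\mapsto Ox+b$ with $b\in\mathbb{F}_q^d$ and $O$ an orthogonal matrix over $\mathbb{F}_q$, $O^TO=I$) with $A(x_i)=y_i$ for all $i$. $T_k^d(E)$ denotes the set of congruence classes of $k$-simplices determined by $E$. *)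

theory Defs
  imports Complex_Main "HOL-Algebra.Coset" "HOL-Algebra.Ring"
begin

text \<open>
  Finite fields are fields in the sense of HOL-Algebra, so that one statement can range over
  infinitely many of them, and a constant can be uniform in the cardinality \<open>q = order R\<close>.
  Vectors of \<open>R\<^sup>d\<close> are extensional functions on \<open>{..<d}\<close>.
\<close>

definition vectors :: "('a, 'b) ring_scheme \<Rightarrow> nat \<Rightarrow> (nat \<Rightarrow> 'a) set" where
  "vectors R d = {..<d} \<rightarrow>\<^sub>E carrier R"

definition zero_vector :: "('a, 'b) ring_scheme \<Rightarrow> nat \<Rightarrow> nat \<Rightarrow> 'a" where
  "zero_vector R d = (\<lambda>i\<in>{..<d}. \<zero>\<^bsub>R\<^esub>)"

definition dot_product ::
    "('a, 'b) ring_scheme \<Rightarrow> nat \<Rightarrow> (nat \<Rightarrow> 'a) \<Rightarrow> (nat \<Rightarrow> 'a) \<Rightarrow> 'a" where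
  "dot_product R d x y = (\<Oplus>\<^bsub>R\<^esub>i\<in>{..<d}. x i \<otimes>\<^bsub>R\<^esub> y i)"

definition nontrivial_additive_character ::
    "('a, 'b) ring_scheme \<Rightarrow> ('a \<Rightarrow> complex) \<Rightarrow> bool" where
  "nontrivial_additive_character R \<chi> \<longleftrightarrow>
     (\<forall>a\<in>carrier R. cmod (\<chi> a) = 1) \<and>
     (\<forall>a\<in>carrier R. \<forall>b\<in>carrier R. \<chi> (a \<oplus>\<^bsub>R\<^esub> b) = \<chi> a * \<chi> b) \<and>
     (\<exists>a\<in>carrier R. \<chi> a \<noteq> 1)"

definition fourier_transform ::
    "('a, 'b) ring_scheme \<Rightarrow> ('a \<Rightarrow> complex) \<Rightarrow> nat \<Rightarrow> (nat \<Rightarrow> 'a) set \<Rightarrow> (nat \<Rightarrow> 'a) \<Rightarrow> complex"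
  where
  "fourier_transform R \<chi> d E x =
     (\<Sum>y\<in>E. \<chi> (\<ominus>\<^bsub>R\<^esub> dot_product R d x y)) / of_nat (order R) ^ d"

definition fourier_norm4 ::
    "('a, 'b) ring_scheme \<Rightarrow> ('a \<Rightarrow> complex) \<Rightarrow> nat \<Rightarrow> (nat \<Rightarrow> 'a) set \<Rightarrow> real" where
  "fourier_norm4 R \<chi> d E =
     ((\<Sum>x\<in>vectors R d - {zero_vector R d}. cmod (fourier_transform R \<chi> d E x) ^ 4)
        / real (order R) ^ d) powr (1/4)"

text \<open>
  The relation \<open>f \<lesssim> g\<close> for quantities depending on a member of a family with index set \<open>I\<close>:
  the implied constant is the same for all members, in particular for all \<open>q\<close>.
\<close>

definition lesssim :: "'i set \<Rightarrow> ('i \<Rightarrow> real) \<Rightarrow> ('i \<Rightarrow> real) \<Rightarrow> bool" where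
  "lesssim I f g \<longleftrightarrow> (\<exists>c>0. \<forall>i\<in>I. f i \<le> c * g i)"

definition salem4 ::
    "'i set \<Rightarrow> ('i \<Rightarrow> 'a ring) \<Rightarrow> ('i \<Rightarrow> 'a \<Rightarrow> complex) \<Rightarrow> nat \<Rightarrow> real \<Rightarrow>
     ('i \<Rightarrow> (nat \<Rightarrow> 'a) set) \<Rightarrow> bool" where
  "salem4 I F \<chi> d s E \<longleftrightarrow>
     lesssim I (\<lambda>i. fourier_norm4 (F i) (\<chi> i) d (E i))
       (\<lambda>i. real (order (F i)) powr (- real d) * real (card (E i)) powr (1 - s))"

definition orthogonal_matrix ::
    "('a, 'b) ring_scheme \<Rightarrow> nat \<Rightarrow> (nat \<Rightarrow> nat \<Rightarrow> 'a) \<Rightarrow> bool" where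
  "orthogonal_matrix R d M \<longleftrightarrow>
     (\<forall>i<d. \<forall>j<d. M i j \<in> carrier R) \<and>
     (\<forall>i<d. \<forall>j<d. (\<Oplus>\<^bsub>R\<^esub>l\<in>{..<d}. M l i \<otimes>\<^bsub>R\<^esub> M l j) = (if i = j then \<one>\<^bsub>R\<^esub> else \<zero>\<^bsub>R\<^esub>))"

definition affine_map ::
    "('a, 'b) ring_scheme \<Rightarrow> nat \<Rightarrow> (nat \<Rightarrow> nat \<Rightarrow> 'a) \<Rightarrow> (nat \<Rightarrow> 'a) \<Rightarrow> (nat \<Rightarrow> 'a) \<Rightarrow> nat \<Rightarrow> 'a"
  where
  "affine_map R d M b x = (\<lambda>i\<in>{..<d}. (\<Oplus>\<^bsub>R\<^esub>j\<in>{..<d}. M i j \<otimes>\<^bsub>R\<^esub> x j) \<oplus>\<^bsub>R\<^esub> b i)"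

text \<open>A \<open>k\<close>-simplex is any \<open>(k+1)\<close>-tuple of points, with vertices indexed by \<open>{..k}\<close>.\<close>

definition simplices :: "nat \<Rightarrow> (nat \<Rightarrow> 'a) set \<Rightarrow> (nat \<Rightarrow> nat \<Rightarrow> 'a) set" where
  "simplices k E = {..k} \<rightarrow>\<^sub>E E"

definition congruent_simplices ::
    "('a, 'b) ring_scheme \<Rightarrow> nat \<Rightarrow> nat \<Rightarrow> (nat \<Rightarrow> nat \<Rightarrow> 'a) \<Rightarrow> (nat \<Rightarrow> nat \<Rightarrow> 'a) \<Rightarrow> bool" where
  "congruent_simplices R d k x y \<longleftrightarrow>
     (\<exists>M b. orthogonal_matrix R d M \<and> b \<in> vectors R d \<and> (\<forall>i\<le>k. affine_map R d M b (x i) = y i))"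

definition congruence_classes ::
    "('a, 'b) ring_scheme \<Rightarrow> nat \<Rightarrow> nat \<Rightarrow> (nat \<Rightarrow> 'a) set \<Rightarrow> (nat \<Rightarrow> nat \<Rightarrow> 'a) set set" where
  "congruence_classes R d k E =
     simplices k E //
       {(x, y). x \<in> simplices k E \<and> y \<in> simplices k E \<and> congruent_simplices R d k x y}"

end

theory Submission
  imports Defs "HOL-Algebra.Group_Action" "HOL-Algebra.Polynomial_Divisibility"
    "HOL-Analysis.Convex" "Jordan_Normal_Form.Missing_Ring"
begin

text \<open>
  By Cauchy--Schwarz over the congruence classes it suffices to bound the number of congruent pairs
  of simplices. Two simplices are congruent iff an orthogonal \<open>g\<close> maps the edge vectors at the first
  vertex of one to those of the other, and the number of such \<open>g\<close> is the order of the pointwise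
  stabilizer of the edge vectors. Adding these vectors one at a time, each orbit lies on a sphere in
  an affine subspace, so the stabilizer makes up at least a fraction
  \<open>1 / (2 ^ k * q ^ (k * d - (k + 1 choose 2)))\<close> of the orthogonal group.

  For a fixed orthogonal \<open>g\<close> let \<open>r(b)\<close> be the number of representations of \<open>b\<close> as a difference of
  an element of \<open>E\<close> and an element of \<open>g E\<close>; the pairs matched by \<open>g\<close> are counted by
  \<open>\<Sum>b. r(b) ^ (k + 1)\<close>. The mean of \<open>r\<close> is \<open>(#E)\<^sup>2 / q ^ d\<close>, and by Plancherel and AM--GM its
  variance is at most the fourth moment of the Fourier transform of \<open>E\<close> off the origin, uniformly in
  \<open>g\<close>. Since \<open>r \<le> #E\<close>, this controls all higher moments.
\<close>

no_notation inner (infix "\<bullet>" 70)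

section \<open>Elementary counting and inequalities\<close>

lemma card_squared_le_card_quotient:
  assumes r: "equiv A r" and A: "finite A"
  shows "(real (card A))\<^sup>2 \<le> real (card (A // r)) * real (card r)"
proof -
  have finite_class: "finite C" if "C \<in> A // r" for C
    using that A r by (meson finite_equiv_class equiv_type)
  have disjoint: "\<forall>B\<in>A // r. \<forall>C\<in>A // r. B \<noteq> C \<longrightarrow> B \<inter> C = {}"
    using quotient_disj [OF r] by blast
  have sum_classes: "(\<Sum>C\<in>A // r. sum f C) = sum f A" for f :: "'a \<Rightarrow> nat"
    using sum.Union_disjoint [of "A // r" f] finite_class disjoint Union_quotient [OF r] by simp
  have "card r = (\<Sum>x\<in>A. card (r `` {x}))"
  proof -
    have "r = (SIGMA x:A. r `` {x})"
      using equiv_type [OF r] by auto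
    then show ?thesis
      using card_SigmaI [of A "\<lambda>x. r `` {x}"] A r finite_class by (metis quotientI)
  qed
  also have "\<dots> = (\<Sum>C\<in>A // r. \<Sum>x\<in>C. card (r `` {x}))"
    by (rule sum_classes [symmetric])
  also have "\<dots> = (\<Sum>C\<in>A // r. \<Sum>x\<in>C. card C)"
  proof (intro sum.cong refl)
    fix C x assume "C \<in> A // r" "x \<in> C"
    then show "card (r `` {x}) = card C"
      by (metis Image_singleton_iff equiv_class_eq quotientE r)
  qed
  finally have "real (card r) = (\<Sum>C\<in>A // r. (real (card C))\<^sup>2)"
    by (simp add: power2_eq_square)
  moreover have "real (card A) = (\<Sum>C\<in>A // r. real (card C))"
    using sum_classes [of "\<lambda>_. 1"] by (simp flip: of_nat_sum)
  ultimately show ?thesis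
    using sum_squared_le_sum_of_squares [of "\<lambda>C. real (card C)" "A // r"]
    by (simp add: mult.commute)
qed

lemma sum_squared_deviation:
  fixes f :: "'a \<Rightarrow> real"
  assumes "finite A" "A \<noteq> {}"
  shows "(\<Sum>x\<in>A. (f x - sum f A / card A)\<^sup>2) = (\<Sum>x\<in>A. (f x)\<^sup>2) - (sum f A)\<^sup>2 / card A"
proof -
  define \<mu> where "\<mu> = sum f A / card A"
  have "(\<Sum>x\<in>A. (f x - \<mu>)\<^sup>2) = (\<Sum>x\<in>A. (f x)\<^sup>2 - 2 * \<mu> * f x + \<mu>\<^sup>2)"
    by (simp add: power2_diff algebra_simps)
  also have "\<dots> = (\<Sum>x\<in>A. (f x)\<^sup>2) - 2 * \<mu> * sum f A + card A * \<mu>\<^sup>2"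
    by (simp add: sum.distrib sum_subtractf sum_distrib_left)
  also have "\<dots> = (\<Sum>x\<in>A. (f x)\<^sup>2) - (sum f A)\<^sup>2 / card A"
    using assms by (simp add: \<mu>_def power2_eq_square field_simps)
  finally show ?thesis
    by (simp add: \<mu>_def)
qed

lemma sum_power_le_deviation:
  fixes f :: "'a \<Rightarrow> real" and M \<mu> :: real
  assumes n: "2 \<le> n" and f: "\<And>x. x \<in> A \<Longrightarrow> 0 \<le> f x" "\<And>x. x \<in> A \<Longrightarrow> f x \<le> M" and \<mu>: "0 \<le> \<mu>"
  shows "(\<Sum>x\<in>A. f x ^ n) \<le> 2 ^ n * (card A * \<mu> ^ n) + 4 * M ^ (n - 2) * (\<Sum>x\<in>A. (f x - \<mu>)\<^sup>2)"
proof -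
  have "f x ^ n \<le> (2 * \<mu>) ^ n + 4 * M ^ (n - 2) * (f x - \<mu>)\<^sup>2" if x: "x \<in> A" for x
  proof (cases "f x \<le> 2 * \<mu>")
    case True
    moreover have "0 \<le> M"
      using f [OF x] by linarith
    ultimately show ?thesis
      using power_mono [of "f x" "2 * \<mu>" n] f(1) [OF x] by (simp add: add_increasing2)
  next
    case False
    have "f x ^ n = f x ^ (n - 2) * (f x)\<^sup>2"
      using n by (metis le_add_diff_inverse2 power_add)
    also have "\<dots> \<le> M ^ (n - 2) * (2 * (f x - \<mu>))\<^sup>2"
      using False f [OF x] by (intro mult_mono power_mono) auto
    also have "\<dots> = 4 * M ^ (n - 2) * (f x - \<mu>)\<^sup>2"
      unfolding power_mult_distrib by simp
    finally show ?thesis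
      using \<mu> by (simp add: add_increasing)
  qed
  then have "(\<Sum>x\<in>A. f x ^ n) \<le> (\<Sum>x\<in>A. (2 * \<mu>) ^ n + 4 * M ^ (n - 2) * (f x - \<mu>)\<^sup>2)"
    by (rule sum_mono)
  then show ?thesis
    by (simp add: sum.distrib sum_distrib_left power_mult_distrib mult_ac)
qed

lemma sum_diff_Suc_add_choose_two: "k \<le> d \<Longrightarrow> (\<Sum>j<k. d - Suc j) + ((k + 1) choose 2) = k * d"
proof (induction k)
  case (Suc k)
  then show ?case
    by (simp add: numeral_2_eq_2)
qed simp

lemma min_le_of_one_le_sum_divide:
  fixes a b \<alpha> \<beta> :: real
  assumes "0 < a" "0 < b" "0 \<le> \<alpha>" "0 \<le> \<beta>" and one_le: "1 \<le> \<alpha> / a + \<beta> / b"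
  shows "min a b \<le> \<alpha> + \<beta>"
proof -
  have "\<alpha> / a + \<beta> / b \<le> \<alpha> / min a b + \<beta> / min a b"
    using assms by (intro add_mono divide_left_mono) auto
  then have "1 \<le> (\<alpha> + \<beta>) / min a b"
    using one_le by (simp add: add_divide_distrib)
  then show ?thesis
    using assms by (simp add: le_divide_eq)
qed

section \<open>Group actions\<close>

context group_action
begin

definition pointwise_stabilizer :: "'c set \<Rightarrow> 'a set" where
  "pointwise_stabilizer A = {g \<in> carrier G. \<forall>x\<in>A. \<phi> g x = x}"

lemma pointwise_stabilizer_empty: "pointwise_stabilizer {} = carrier G"
  by (simp add: pointwise_stabilizer_def)

lemma pointwise_stabilizer_insert:
  "pointwise_stabilizer (insert x A) = {g \<in> pointwise_stabilizer A. \<phi> g x = x}"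
  by (auto simp: pointwise_stabilizer_def)

lemma subgroup_pointwise_stabilizer:
  assumes A: "A \<subseteq> E"
  shows "subgroup (pointwise_stabilizer A) G"
proof -
  interpret group G
    using group_hom group_hom.axioms(1) by auto
  show ?thesis
  proof (rule subgroup.intro)
    show "\<one> \<in> pointwise_stabilizer A"
      using A by (auto simp: pointwise_stabilizer_def simp flip: id_eq_one)
    show "g \<otimes> h \<in> pointwise_stabilizer A"
      if "g \<in> pointwise_stabilizer A" "h \<in> pointwise_stabilizer A" for g h
      using that A by (auto simp: pointwise_stabilizer_def subset_iff composition_rule)
    show "inv g \<in> pointwise_stabilizer A" if "g \<in> pointwise_stabilizer A" for g
      using that A orbit_sym_aux by (auto simp: pointwise_stabilizer_def subset_iff)
  qed (auto simp: pointwise_stabilizer_def)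
qed

lemma card_pointwise_stabilizer_insert:
  assumes "A \<subseteq> E" "x \<in> E"
  shows "card (pointwise_stabilizer A) =
    card ((\<lambda>g. \<phi> g x) ` pointwise_stabilizer A) * card (pointwise_stabilizer (insert x A))"
proof -
  interpret A: group_action "G\<lparr>carrier := pointwise_stabilizer A\<rparr>" E \<phi>
    using assms(1) by (intro induced_action subgroup_pointwise_stabilizer)
  show ?thesis
    using A.orbit_stabilizer_theorem [OF assms(2)]
    by (simp add: orbit_def stabilizer_def order_def pointwise_stabilizer_insert Setcompr_eq_image)
qed

lemma card_agreeing_eq_pointwise_stabilizer:
  assumes A: "A \<subseteq> E" and h: "h \<in> carrier G"
  shows "card {g \<in> carrier G. \<forall>x\<in>A. \<phi> g x = \<phi> h x} = card (pointwise_stabilizer A)"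
proof -
  interpret group G
    using group_hom group_hom.axioms(1) by auto
  have "bij_betw (\<lambda>g. h \<otimes> g) (pointwise_stabilizer A) {g \<in> carrier G. \<forall>x\<in>A. \<phi> g x = \<phi> h x}"
    by (rule bij_betw_byWitness [where f' = "\<lambda>g. inv h \<otimes> g"])
      (use A h in \<open>auto simp: pointwise_stabilizer_def subset_iff composition_rule orbit_sym_aux
        simp flip: m_assoc\<close>)
  then show ?thesis
    by (simp add: bij_betw_same_card)
qed

end

section \<open>Equations over a field\<close>

lemma (in abelian_group) double_eq_zero_imp_eq_zero:
  assumes "odd (order G)" "a \<in> carrier G" "a \<oplus> a = \<zero>"
  shows "a = \<zero>"
proof -
  obtain m where m: "order G = 2 * m + 1"
    using assms(1) by (elim oddE)
  have "[order (add_monoid G)] \<cdot> a = \<zero>"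
    using assms(2) by (intro add.pow_order_eq_1) simp
  then have "[(m * 2 + 1)] \<cdot> a = \<zero>"
    using m by (simp add: order_def mult.commute)
  moreover have "[(2::nat)] \<cdot> a = \<zero>"
    using assms(2,3) by (simp add: numeral_2_eq_2)
  ultimately show ?thesis
    using assms(2) by (simp add: mult.commute [of m] flip: add.nat_pow_mult add.nat_pow_pow)
qed

lemma (in field) card_linear_roots:
  assumes "a \<in> carrier R" "b \<in> carrier R" "a \<noteq> \<zero>"
  shows "card {t \<in> carrier R. a \<otimes> t \<oplus> b = \<zero>} = 1"
proof -
  have a: "a \<in> Units R"
    using assms by (simp add: field_Units)
  have "a \<otimes> t \<oplus> b = \<zero> \<longleftrightarrow> t = inv a \<otimes> \<ominus> b" if t: "t \<in> carrier R" for t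
  proof -
    have "a \<otimes> t \<oplus> b = \<zero> \<longleftrightarrow> a \<otimes> t = \<ominus> b"
      using assms t by (metis add.inv_equality l_neg m_closed minus_minus)
    also have "\<dots> \<longleftrightarrow> t = inv a \<otimes> \<ominus> b"
      using a assms t by (metis Units_inv_closed Units_l_inv Units_r_inv a_inv_closed l_one m_assoc)
    finally show ?thesis .
  qed
  then have "{t \<in> carrier R. a \<otimes> t \<oplus> b = \<zero>} = {inv a \<otimes> \<ominus> b}"
    using a assms by auto
  then show ?thesis
    by simp
qed

lemma (in field) card_quadratic_roots_le:
  assumes "a \<in> carrier R" "b \<in> carrier R" "c \<in> carrier R" and "a \<noteq> \<zero> \<or> b \<noteq> \<zero>"
  shows "card {t \<in> carrier R. a \<otimes> t \<otimes> t \<oplus> b \<otimes> t \<oplus> c = \<zero>} \<le> 2"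
proof -
  define p where "p = normalize [a, b, c]"
  have p: "p \<in> carrier (poly_ring R)"
    using assms unfolding p_def univ_poly_carrier [symmetric]
    by (intro normalize_gives_polynomial) simp
  have "p \<noteq> []"
    using assms(4) by (auto simp: p_def)
  have "eval p t = a \<otimes> t \<otimes> t \<oplus> b \<otimes> t \<oplus> c" if "t \<in> carrier R" for t
    using that assms unfolding p_def
    by (subst eval_normalize) (auto simp: numeral_2_eq_2 m_assoc a_assoc)
  then have "{t \<in> carrier R. a \<otimes> t \<otimes> t \<oplus> b \<otimes> t \<oplus> c = \<zero>} = set_mset (roots p)"
    using \<open>p \<noteq> []\<close> by (auto simp: roots_mem_iff_is_root [OF p] is_root_def)
  also have "card \<dots> \<le> size (roots p)"
    by (simp add: size_multiset_overloaded_eq) (metis card_eq_sum count_greater_eq_one_iff sum_mono)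
  also have "\<dots> \<le> degree p"
    by (rule size_roots_le_degree [OF p])
  also have "\<dots> \<le> 2"
    using normalize_length_le [of "[a, b, c]"] by (simp add: p_def)
  finally show ?thesis .
qed

section \<open>Coordinate spaces\<close>

text \<open>A module record also has ring operations, which the module axioms ignore.\<close>

definition coordinate_module :: "('a, 'b) ring_scheme \<Rightarrow> nat \<Rightarrow> ('a, nat \<Rightarrow> 'a) module" where
  "coordinate_module R d =
     \<lparr>carrier = vectors R d, monoid.mult = undefined, one = undefined,
      zero = zero_vector R d, add = \<lambda>x y. \<lambda>i\<in>{..<d}. x i \<oplus>\<^bsub>R\<^esub> y i,
      smult = \<lambda>c x. \<lambda>i\<in>{..<d}. c \<otimes>\<^bsub>R\<^esub> x i\<rparr>"

lemma (in cring) module_coordinate_module: "module R (coordinate_module R d)"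
proof (rule moduleI)
  show "abelian_group (coordinate_module R d)"
  proof (rule abelian_groupI)
    fix x assume "x \<in> carrier (coordinate_module R d)"
    then show "\<exists>y\<in>carrier (coordinate_module R d).
        y \<oplus>\<^bsub>coordinate_module R d\<^esub> x = \<zero>\<^bsub>coordinate_module R d\<^esub>"
      by (intro bexI [of _ "\<lambda>i\<in>{..<d}. \<ominus> x i"])
        (auto simp: coordinate_module_def vectors_def zero_vector_def PiE_iff l_neg)
  qed (auto simp: coordinate_module_def vectors_def zero_vector_def PiE_iff a_ac extensional_def)
qed (auto simp: coordinate_module_def vectors_def PiE_iff l_distr r_distr m_assoc extensional_def
    intro: is_cring)

lemma simplex_vertex_closed: "x \<in> simplices k E \<Longrightarrow> i \<le> k \<Longrightarrow> x i \<in> E"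
  by (auto simp: simplices_def)

lemma simplices_mono: "E \<subseteq> F \<Longrightarrow> simplices k E \<subseteq> simplices k F"
  by (auto simp: simplices_def PiE_iff)

lemma finite_simplices: "finite E \<Longrightarrow> finite (simplices k E)"
  by (simp add: simplices_def finite_PiE)

lemma simplex_eqI:
  "x \<in> simplices k E \<Longrightarrow> y \<in> simplices k E \<Longrightarrow> (\<And>i. i \<le> k \<Longrightarrow> x i = y i) \<Longrightarrow> x = y"
  by (rule PiE_ext [of x "{..k}" "\<lambda>_. E"]) (simp_all add: simplices_def)

locale finite_coordinate_space = cring R for R (structure) +
  fixes d :: nat
  assumes finite_carrier: "finite (carrier R)"
begin

abbreviation V :: "(nat \<Rightarrow> 'a) set" where "V \<equiv> vectors R d"

abbreviation zero_vec :: "nat \<Rightarrow> 'a" ("\<zero>\<^sub>v") where "\<zero>\<^sub>v \<equiv> zero_vector R d"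

abbreviation add_vec :: "(nat \<Rightarrow> 'a) \<Rightarrow> (nat \<Rightarrow> 'a) \<Rightarrow> nat \<Rightarrow> 'a" (infixl "+\<^sub>v" 65) where
  "x +\<^sub>v y \<equiv> x \<oplus>\<^bsub>coordinate_module R d\<^esub> y"

abbreviation minus_vec :: "(nat \<Rightarrow> 'a) \<Rightarrow> (nat \<Rightarrow> 'a) \<Rightarrow> nat \<Rightarrow> 'a" (infixl "-\<^sub>v" 65) where
  "x -\<^sub>v y \<equiv> x \<ominus>\<^bsub>coordinate_module R d\<^esub> y"

abbreviation smult_vec :: "'a \<Rightarrow> (nat \<Rightarrow> 'a) \<Rightarrow> nat \<Rightarrow> 'a" (infixr "\<cdot>\<^sub>v" 70) where
  "c \<cdot>\<^sub>v x \<equiv> c \<odot>\<^bsub>coordinate_module R d\<^esub> x"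

abbreviation dot :: "(nat \<Rightarrow> 'a) \<Rightarrow> (nat \<Rightarrow> 'a) \<Rightarrow> 'a" (infixl "\<bullet>" 75) where
  "x \<bullet> y \<equiv> dot_product R d x y"

lemma carrier_coordinate_module: "carrier (coordinate_module R d) = V"
  and zero_coordinate_module: "\<zero>\<^bsub>coordinate_module R d\<^esub> = \<zero>\<^sub>v"
  by (simp_all add: coordinate_module_def)

sublocale vec: module R "coordinate_module R d"
  rewrites "carrier (coordinate_module R d) = V"
    and "\<zero>\<^bsub>coordinate_module R d\<^esub> = \<zero>\<^sub>v"
  by (fact module_coordinate_module carrier_coordinate_module zero_coordinate_module)+

lemma vec_index_closed [simp, intro]: "x \<in> V \<Longrightarrow> i < d \<Longrightarrow> x i \<in> carrier R"
  unfolding vectors_def by auto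

lemma finite_V [simp]: "finite V"
  unfolding vectors_def using finite_carrier by (simp add: finite_PiE)

lemma finite_subset_V: "E \<subseteq> V \<Longrightarrow> finite E"
  using finite_subset finite_V by blast

lemma card_V: "card V = order R ^ d"
  unfolding vectors_def order_def by (simp add: card_PiE)

lemma order_pos: "order R > 0"
  using finite_carrier by (auto simp: order_def card_gt_0_iff)

lemma vec_eqI: "x \<in> V \<Longrightarrow> y \<in> V \<Longrightarrow> (\<And>i. i < d \<Longrightarrow> x i = y i) \<Longrightarrow> x = y"
  unfolding vectors_def by (rule PiE_ext) auto

lemma index_zero_vec [simp]: "i < d \<Longrightarrow> \<zero>\<^sub>v i = \<zero>"
  and index_add_vec [simp]: "i < d \<Longrightarrow> (x +\<^sub>v y) i = x i \<oplus> y i"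
  and index_smult_vec [simp]: "i < d \<Longrightarrow> (c \<cdot>\<^sub>v x) i = c \<otimes> x i"
  by (simp_all add: zero_vector_def coordinate_module_def)

lemma minus_vec_add_cancel [simp]: "x \<in> V \<Longrightarrow> y \<in> V \<Longrightarrow> x -\<^sub>v y +\<^sub>v y = x"
  by (simp add: a_minus_def vec.M.a_assoc vec.M.l_neg)

lemma add_vec_minus_cancel [simp]: "x \<in> V \<Longrightarrow> y \<in> V \<Longrightarrow> x +\<^sub>v y -\<^sub>v y = x"
  by (simp add: a_minus_def vec.M.a_assoc vec.M.r_neg)

lemma add_vec_minus_add_vec:
  assumes "x \<in> V" "y \<in> V" "z \<in> V"
  shows "(x +\<^sub>v z) -\<^sub>v (y +\<^sub>v z) = x -\<^sub>v y"
proof -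
  let ?uminus = "a_inv (coordinate_module R d)"
  have "(x +\<^sub>v z) -\<^sub>v (y +\<^sub>v z) = x +\<^sub>v (z +\<^sub>v (?uminus z +\<^sub>v ?uminus y))"
    using assms by (simp add: a_minus_def vec.M.minus_add vec.M.a_ac)
  also have "\<dots> = x -\<^sub>v y"
    using assms by (simp add: a_minus_def vec.M.r_neg2)
  finally show ?thesis .
qed

lemma dot_closed [simp, intro]: "x \<in> V \<Longrightarrow> y \<in> V \<Longrightarrow> x \<bullet> y \<in> carrier R"
  unfolding dot_product_def by (rule finsum_closed) auto

lemma dot_commute: "x \<in> V \<Longrightarrow> y \<in> V \<Longrightarrow> x \<bullet> y = y \<bullet> x"
  unfolding dot_product_def by (rule finsum_cong') (auto simp: m_comm)

lemma dot_add_left: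
  assumes "x \<in> V" "y \<in> V" "z \<in> V"
  shows "(x +\<^sub>v y) \<bullet> z = x \<bullet> z \<oplus> y \<bullet> z"
proof -
  have "(x +\<^sub>v y) \<bullet> z = (\<Oplus>i\<in>{..<d}. x i \<otimes> z i \<oplus> y i \<otimes> z i)"
    unfolding dot_product_def using assms by (intro finsum_cong') (auto simp: l_distr)
  also have "\<dots> = x \<bullet> z \<oplus> y \<bullet> z"
    unfolding dot_product_def using assms by (intro finsum_addf) auto
  finally show ?thesis .
qed

lemma dot_smult_left: "c \<in> carrier R \<Longrightarrow> x \<in> V \<Longrightarrow> z \<in> V \<Longrightarrow> (c \<cdot>\<^sub>v x) \<bullet> z = c \<otimes> (x \<bullet> z)"
  unfolding dot_product_def
  by (subst finsum_rdistr) (auto simp: m_assoc intro!: finsum_cong')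

lemma dot_minus_left:
  assumes "x \<in> V" "y \<in> V" "z \<in> V"
  shows "(x -\<^sub>v y) \<bullet> z = x \<bullet> z \<ominus> y \<bullet> z"
proof -
  have "x \<bullet> z = (x -\<^sub>v y) \<bullet> z \<oplus> y \<bullet> z"
    using assms by (subst dot_add_left [symmetric]) auto
  then show ?thesis
    using assms by (simp add: minus_eq a_assoc r_neg)
qed

lemma dot_zero_left [simp]: "x \<in> V \<Longrightarrow> \<zero>\<^sub>v \<bullet> x = \<zero>"
  using dot_smult_left [of \<zero> "\<zero>\<^sub>v" x] by simp

lemma dot_add_right: "x \<in> V \<Longrightarrow> y \<in> V \<Longrightarrow> z \<in> V \<Longrightarrow> z \<bullet> (x +\<^sub>v y) = z \<bullet> x \<oplus> z \<bullet> y"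
  and dot_smult_right: "c \<in> carrier R \<Longrightarrow> x \<in> V \<Longrightarrow> z \<in> V \<Longrightarrow> z \<bullet> (c \<cdot>\<^sub>v x) = c \<otimes> (z \<bullet> x)"
  and dot_minus_right: "x \<in> V \<Longrightarrow> y \<in> V \<Longrightarrow> z \<in> V \<Longrightarrow> z \<bullet> (x -\<^sub>v y) = z \<bullet> x \<ominus> z \<bullet> y"
  and dot_zero_right [simp]: "z \<in> V \<Longrightarrow> z \<bullet> \<zero>\<^sub>v = \<zero>"
  by (simp_all add: dot_commute [of z] dot_add_left dot_smult_left dot_minus_left)

lemma dot_self_add_smult:
  assumes y: "y \<in> V" and u: "u \<in> V" and t: "t \<in> carrier R"
  shows "(y +\<^sub>v t \<cdot>\<^sub>v u) \<bullet> (y +\<^sub>v t \<cdot>\<^sub>v u) =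
    (u \<bullet> u) \<otimes> t \<otimes> t \<oplus> (y \<bullet> u \<oplus> y \<bullet> u) \<otimes> t \<oplus> y \<bullet> y"
proof -
  have "(y +\<^sub>v t \<cdot>\<^sub>v u) \<bullet> (y +\<^sub>v t \<cdot>\<^sub>v u) =
      y \<bullet> y \<oplus> t \<otimes> (y \<bullet> u) \<oplus> (t \<otimes> (y \<bullet> u) \<oplus> t \<otimes> (t \<otimes> (u \<bullet> u)))"
    using assms by (simp add: dot_add_left dot_add_right dot_smult_left dot_smult_right
        dot_commute [of u y] r_distr)
  also have "\<dots> = (u \<bullet> u) \<otimes> t \<otimes> t \<oplus> (y \<bullet> u \<oplus> y \<bullet> u) \<otimes> t \<oplus> y \<bullet> y"
    using dot_closed [OF u u] dot_closed [OF y u] dot_closed [OF y y] t by algebra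
  finally show ?thesis .
qed

definition unit_vec :: "nat \<Rightarrow> nat \<Rightarrow> 'a" where
  "unit_vec j = (\<lambda>i\<in>{..<d}. if i = j then \<one> else \<zero>)"

lemma unit_vec_closed [simp, intro]: "unit_vec j \<in> V"
  by (auto simp: unit_vec_def vectors_def)

lemma dot_unit_vec [simp]:
  assumes "x \<in> V" "j < d"
  shows "x \<bullet> unit_vec j = x j"
proof -
  have "x \<bullet> unit_vec j = (\<Oplus>i\<in>{..<d}. if j = i then x i else \<zero>)"
    unfolding dot_product_def unit_vec_def using assms by (intro finsum_cong') auto
  also have "\<dots> = x j"
    using assms by (intro add.finprod_singleton) auto
  finally show ?thesis .
qed

lemma dot_nondegenerate: "x \<in> V \<Longrightarrow> y \<in> V \<Longrightarrow> (\<And>z. z \<in> V \<Longrightarrow> x \<bullet> z = y \<bullet> z) \<Longrightarrow> x = y"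
  by (intro vec_eqI) (metis dot_unit_vec unit_vec_closed)+

section \<open>The orthogonal group\<close>

text \<open>A self-map of \<open>V\<close> that preserves the dot product is automatically linear.\<close>

definition isometries :: "((nat \<Rightarrow> 'a) \<Rightarrow> nat \<Rightarrow> 'a) set" where
  "isometries = {g \<in> V \<rightarrow>\<^sub>E V. \<forall>x\<in>V. \<forall>y\<in>V. g x \<bullet> g y = x \<bullet> y}"

definition orthogonal_group :: "((nat \<Rightarrow> 'a) \<Rightarrow> nat \<Rightarrow> 'a) monoid" where
  "orthogonal_group = BijGroup V\<lparr>carrier := isometries\<rparr>"

lemma restrict_isometryI:
  "(\<And>x. x \<in> V \<Longrightarrow> g x \<in> V) \<Longrightarrow> (\<And>x y. x \<in> V \<Longrightarrow> y \<in> V \<Longrightarrow> g x \<bullet> g y = x \<bullet> y) \<Longrightarrow>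
    restrict g V \<in> isometries"
  by (simp add: isometries_def)

lemma isometry_extensional: "g \<in> isometries \<Longrightarrow> g \<in> extensional V"
  by (simp add: isometries_def PiE_def)

lemma isometry_eqI:
  "g \<in> isometries \<Longrightarrow> h \<in> isometries \<Longrightarrow> (\<And>x. x \<in> V \<Longrightarrow> g x = h x) \<Longrightarrow> g = h"
  by (rule extensionalityI [OF isometry_extensional isometry_extensional])

lemma finite_isometries [simp]: "finite isometries"
  by (rule finite_subset [of _ "V \<rightarrow>\<^sub>E V"]) (auto simp: isometries_def finite_PiE)

lemma isometry_closed [simp, intro]: "g \<in> isometries \<Longrightarrow> x \<in> V \<Longrightarrow> g x \<in> V"
  and isometry_dot [simp]: "g \<in> isometries \<Longrightarrow> x \<in> V \<Longrightarrow> y \<in> V \<Longrightarrow> g x \<bullet> g y = x \<bullet> y"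
  by (auto simp: isometries_def)

lemma bij_betw_isometry:
  assumes g: "g \<in> isometries"
  shows "bij_betw g V V"
proof -
  have "inj_on g V"
  proof (rule inj_onI)
    fix x y assume "x \<in> V" "y \<in> V" "g x = g y"
    then show "x = y"
      using g by (intro dot_nondegenerate) (metis isometry_dot)+
  qed
  moreover have "g ` V \<subseteq> V"
    using g by auto
  ultimately show ?thesis
    by (simp add: bij_betw_def endo_inj_surj)
qed

lemma isometries_subset_Bij: "isometries \<subseteq> Bij V"
  by (simp add: Bij_def subset_iff bij_betw_isometry isometry_extensional)

lemma subgroup_isometries: "subgroup isometries (BijGroup V)"
proof (rule group.subgroupI [OF group_BijGroup])
  show "isometries \<subseteq> carrier (BijGroup V)"
    using isometries_subset_Bij by (simp add: BijGroup_def)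
  have "(\<lambda>x\<in>V. x) \<in> isometries"
    by (rule restrict_isometryI) simp_all
  then show "isometries \<noteq> {}"
    by blast
  fix g assume g: "g \<in> isometries"
  have closed: "inv_into V g x \<in> V" and right: "g (inv_into V g x) = x" if "x \<in> V" for x
    using bij_betw_isometry [OF g] that by (auto simp: bij_betw_def inv_into_into f_inv_into_f)
  have "restrict (inv_into V g) V \<in> isometries"
  proof (rule restrict_isometryI)
    show "inv_into V g x \<bullet> inv_into V g y = x \<bullet> y" if "x \<in> V" "y \<in> V" for x y
      using isometry_dot [OF g closed closed] that by (simp add: right)
  qed (rule closed)
  moreover have "inv\<^bsub>BijGroup V\<^esub> g = restrict (inv_into V g) V"
    using g isometries_subset_Bij by (blast intro: inv_BijGroup)
  ultimately show "inv\<^bsub>BijGroup V\<^esub> g \<in> isometries"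
    by simp
  fix h assume h: "h \<in> isometries"
  have "g \<otimes>\<^bsub>BijGroup V\<^esub> h = (\<lambda>x\<in>V. g (h x))"
    using subsetD [OF isometries_subset_Bij] g h by (simp add: BijGroup_def compose_def)
  moreover have "(\<lambda>x\<in>V. g (h x)) \<in> isometries"
    using g h by (intro restrict_isometryI) auto
  ultimately show "g \<otimes>\<^bsub>BijGroup V\<^esub> h \<in> isometries"
    by simp
qed

lemma group_orthogonal_group: "group orthogonal_group"
  unfolding orthogonal_group_def
  by (rule group.subgroup_imp_group [OF group_BijGroup subgroup_isometries])

lemma carrier_orthogonal_group: "carrier orthogonal_group = isometries"
  by (simp add: orthogonal_group_def)

sublocale orthogonal: group_action orthogonal_group V "\<lambda>g. g"
  rewrites "carrier orthogonal_group = isometries"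
proof -
  have "group_hom orthogonal_group (BijGroup V) (\<lambda>g. g)"
    using group.canonical_inj_is_hom [OF group_BijGroup subgroup_isometries]
    by (simp add: orthogonal_group_def id_def)
  then show "group_action orthogonal_group V (\<lambda>g. g)"
    by (rule group_action.intro)
qed (rule carrier_orthogonal_group)

lemma one_isometry: "\<one>\<^bsub>orthogonal_group\<^esub> \<in> isometries"
  and mult_isometry: "g \<in> isometries \<Longrightarrow> h \<in> isometries \<Longrightarrow> g \<otimes>\<^bsub>orthogonal_group\<^esub> h \<in> isometries"
  and inv_isometry: "g \<in> isometries \<Longrightarrow> inv\<^bsub>orthogonal_group\<^esub> g \<in> isometries"
  using group.is_monoid [OF group_orthogonal_group] group.inv_closed [OF group_orthogonal_group]
  by (simp_all add: monoid.one_closed monoid.m_closed flip: carrier_orthogonal_group)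

lemma isometry_preimage: "g \<in> isometries \<Longrightarrow> y \<in> V \<Longrightarrow> \<exists>x\<in>V. g x = y"
  using orthogonal.bij_prop1 by blast

lemma isometry_nondegenerate:
  assumes "g \<in> isometries" "x \<in> V" "y \<in> V" "\<And>z. z \<in> V \<Longrightarrow> x \<bullet> g z = y \<bullet> g z"
  shows "x = y"
  using assms by (intro dot_nondegenerate) (metis isometry_preimage)+

lemma isometry_minus: "g \<in> isometries \<Longrightarrow> x \<in> V \<Longrightarrow> y \<in> V \<Longrightarrow> g (x -\<^sub>v y) = g x -\<^sub>v g y"
  by (rule isometry_nondegenerate [of g]) (simp_all add: dot_minus_left)

lemma isometry_zero: "g \<in> isometries \<Longrightarrow> g \<zero>\<^sub>v = \<zero>\<^sub>v"
  by (rule isometry_nondegenerate [of g]) simp_all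

lemma isometry_eq_on_unit_vecs:
  assumes g: "g \<in> isometries" and h: "h \<in> isometries"
    and eq: "\<And>j. j < d \<Longrightarrow> g (unit_vec j) = h (unit_vec j)"
  shows "g = h"
proof (rule isometry_eqI [OF g h])
  fix x assume x: "x \<in> V"
  obtain y where y: "y \<in> V" "h y = g x"
    using isometry_preimage [OF h isometry_closed [OF g x]] by blast
  have "y j = x j" if j: "j < d" for j
  proof -
    have "y j = h y \<bullet> h (unit_vec j)"
      using h y(1) j by simp
    also have "\<dots> = g x \<bullet> g (unit_vec j)"
      by (simp only: y(2) eq [OF j])
    also have "\<dots> = x j"
      using g x j by simp
    finally show ?thesis .
  qed
  then have "y = x"
    by (rule vec_eqI [OF y(1) x])
  then show "g x = h x"
    using y(2) by simp
qed

subsection \<open>Orthogonal matrices\<close>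

definition mult_mat_vec :: "(nat \<Rightarrow> nat \<Rightarrow> 'a) \<Rightarrow> (nat \<Rightarrow> 'a) \<Rightarrow> nat \<Rightarrow> 'a" where
  "mult_mat_vec M x = (\<lambda>i\<in>{..<d}. \<Oplus>j\<in>{..<d}. M i j \<otimes> x j)"

lemma affine_map_eq_mult_mat_vec: "affine_map R d M b x = mult_mat_vec M x +\<^sub>v b"
  by (auto simp: affine_map_def mult_mat_vec_def coordinate_module_def intro: restrict_ext)

lemma mult_mat_vec_closed:
  "(\<And>i j. i < d \<Longrightarrow> j < d \<Longrightarrow> M i j \<in> carrier R) \<Longrightarrow> x \<in> V \<Longrightarrow> mult_mat_vec M x \<in> V"
  by (auto simp: mult_mat_vec_def vectors_def PiE_iff intro!: finsum_closed)

lemma mult_mat_vec_unit_vec: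
  assumes "\<And>i j. i < d \<Longrightarrow> j < d \<Longrightarrow> M i j \<in> carrier R" "i < d" "j < d"
  shows "mult_mat_vec M (unit_vec j) i = M i j"
proof -
  have "mult_mat_vec M (unit_vec j) i = (\<lambda>l\<in>{..<d}. M i l) \<bullet> unit_vec j"
    using assms by (auto simp: mult_mat_vec_def dot_product_def unit_vec_def intro!: finsum_cong')
  then show ?thesis
    using assms by (simp add: vectors_def)
qed

lemma dot_mult_mat_vec:
  assumes M: "\<And>i j. i < d \<Longrightarrow> j < d \<Longrightarrow> M i j \<in> carrier R" and x: "x \<in> V" and y: "y \<in> V"
  shows "mult_mat_vec M x \<bullet> y = x \<bullet> mult_mat_vec (\<lambda>i j. M j i) y"
proof -
  have "mult_mat_vec M x \<bullet> y = (\<Oplus>i\<in>{..<d}. \<Oplus>j\<in>{..<d}. M i j \<otimes> x j \<otimes> y i)"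
    using M x y by (auto simp: dot_product_def mult_mat_vec_def finsum_ldistr intro!: finsum_cong')
  also have "\<dots> = (\<Oplus>j\<in>{..<d}. \<Oplus>i\<in>{..<d}. M i j \<otimes> x j \<otimes> y i)"
    using M x y by (intro finsum_finsum_swap) auto
  also have "\<dots> = x \<bullet> mult_mat_vec (\<lambda>i j. M j i) y"
    using M x y
    by (auto simp: dot_product_def mult_mat_vec_def finsum_rdistr m_ac intro!: finsum_cong')
  finally show ?thesis .
qed

lemma orthogonal_matrix_isometry:
  assumes "orthogonal_matrix R d M"
  shows "restrict (mult_mat_vec M) V \<in> isometries"
proof -
  have M: "M i j \<in> carrier R" if "i < d" "j < d" for i j
    using assms that by (simp add: orthogonal_matrix_def)
  let ?T = "mult_mat_vec (\<lambda>i j. M j i)"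
  have closed: "mult_mat_vec M x \<in> V" "?T x \<in> V" if "x \<in> V" for x
    using M that by (simp_all add: mult_mat_vec_closed)
  have unit: "?T (mult_mat_vec M (unit_vec j)) = unit_vec j" if j: "j < d" for j
  proof (rule vec_eqI)
    fix i assume i: "i < d"
    have "?T (mult_mat_vec M (unit_vec j)) i = (\<Oplus>l\<in>{..<d}. M l i \<otimes> M l j)"
      unfolding mult_mat_vec_def [of "\<lambda>i j. M j i"] using M i j
      by (auto simp: mult_mat_vec_unit_vec intro!: finsum_cong')
    then show "?T (mult_mat_vec M (unit_vec j)) i = unit_vec j i"
      using assms i j by (simp add: orthogonal_matrix_def unit_vec_def)
  qed (simp_all add: closed)
  have inverse: "?T (mult_mat_vec M x) = x" if x: "x \<in> V" for x
  proof (rule vec_eqI)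
    fix j assume j: "j < d"
    have "?T (mult_mat_vec M x) j = ?T (mult_mat_vec M x) \<bullet> unit_vec j"
      using x j closed by simp
    also have "\<dots> = mult_mat_vec M x \<bullet> mult_mat_vec M (unit_vec j)"
      using M x j closed by (subst dot_mult_mat_vec) auto
    also have "\<dots> = x \<bullet> unit_vec j"
      using M x j closed by (subst dot_mult_mat_vec) (auto simp: unit)
    finally show "?T (mult_mat_vec M x) j = x j"
      using x j by simp
  qed (simp_all add: closed x)
  have "mult_mat_vec M x \<bullet> mult_mat_vec M y = x \<bullet> y" if "x \<in> V" "y \<in> V" for x y
    using that M closed by (subst dot_mult_mat_vec) (auto simp: inverse)
  then show ?thesis
    using closed by (intro restrict_isometryI)
qed

lemma isometry_orthogonal_matrix:
  assumes g: "g \<in> isometries"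
  obtains M where "orthogonal_matrix R d M" "\<And>x. x \<in> V \<Longrightarrow> mult_mat_vec M x = g x"
proof
  let ?M = "\<lambda>i j. g (unit_vec j) i"
  have "(\<Oplus>l\<in>{..<d}. ?M l i \<otimes> ?M l j) = (if i = j then \<one> else \<zero>)" if "i < d" "j < d" for i j
  proof -
    have "g (unit_vec i) \<bullet> g (unit_vec j) = unit_vec i j"
      using g that by simp
    then show ?thesis
      using that by (auto simp: dot_product_def unit_vec_def)
  qed
  then show M: "orthogonal_matrix R d ?M"
    using g by (auto simp: orthogonal_matrix_def)
  have "mult_mat_vec ?M (unit_vec j) = g (unit_vec j)" if "j < d" for j
    using that g by (intro vec_eqI) (auto simp: mult_mat_vec_unit_vec intro: mult_mat_vec_closed)
  then have "restrict (mult_mat_vec ?M) V = g"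
    by (intro isometry_eq_on_unit_vecs orthogonal_matrix_isometry M g) simp
  then show "mult_mat_vec ?M x = g x" if "x \<in> V" for x
    using that by (metis restrict_apply')
qed

subsection \<open>Congruence of simplices\<close>

abbreviation maps_edges ::
    "nat \<Rightarrow> ((nat \<Rightarrow> 'a) \<Rightarrow> nat \<Rightarrow> 'a) \<Rightarrow> (nat \<Rightarrow> nat \<Rightarrow> 'a) \<Rightarrow> (nat \<Rightarrow> nat \<Rightarrow> 'a) \<Rightarrow> bool" where
  "maps_edges k g x y \<equiv> \<forall>i\<in>{1..k}. g (x i -\<^sub>v x 0) = y i -\<^sub>v y 0"

lemma maps_edges_imp_translate:
  assumes x: "x \<in> simplices k V" and y: "y \<in> simplices k V"
    and g: "g \<in> isometries" "maps_edges k g x y" and i: "i \<le> k"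
  shows "g (x i) +\<^sub>v (y 0 -\<^sub>v g (x 0)) = y i"
proof -
  have closed: "x 0 \<in> V" "y 0 \<in> V" "x i \<in> V" "y i \<in> V"
    using x y i by (auto intro: simplex_vertex_closed)
  have "g (x i) +\<^sub>v (y 0 -\<^sub>v g (x 0)) = (g (x i) -\<^sub>v g (x 0)) +\<^sub>v y 0"
    using g closed by (simp add: a_minus_def vec.M.a_ac)
  also have "\<dots> = (y i -\<^sub>v y 0) +\<^sub>v y 0"
  proof (cases "i = 0")
    case True
    then show ?thesis
      using closed isometry_closed [OF g(1)] by (simp add: a_minus_def vec.M.r_neg)
  next
    case False
    then show ?thesis
      using g(2) isometry_minus [OF g(1) closed(3,1)] i by simp
  qed
  finally show ?thesis
    using closed by simp
qed

lemma translate_imp_maps_edges: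
  assumes x: "x \<in> simplices k V" and g: "g \<in> isometries" and b: "b \<in> V"
    and y: "\<forall>i\<le>k. g (x i) +\<^sub>v b = y i"
  shows "maps_edges k g x y"
proof
  fix i assume i: "i \<in> {1..k}"
  have closed: "x 0 \<in> V" "x i \<in> V"
    using x i by (auto intro: simplex_vertex_closed)
  have "g (x i -\<^sub>v x 0) = g (x i) -\<^sub>v g (x 0)"
    by (rule isometry_minus [OF g closed(2,1)])
  also have "\<dots> = (g (x i) +\<^sub>v b) -\<^sub>v (g (x 0) +\<^sub>v b)"
    using isometry_closed [OF g closed(2)] isometry_closed [OF g closed(1)] b
    by (rule add_vec_minus_add_vec [symmetric])
  also have "\<dots> = y i -\<^sub>v y 0"
    using y i by simp
  finally show "g (x i -\<^sub>v x 0) = y i -\<^sub>v y 0" .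
qed

lemma congruent_simplices_iff_maps_edges:
  assumes x: "x \<in> simplices k V" and y: "y \<in> simplices k V"
  shows "congruent_simplices R d k x y \<longleftrightarrow> (\<exists>g\<in>isometries. maps_edges k g x y)"
proof
  assume "congruent_simplices R d k x y"
  then obtain M b where M: "orthogonal_matrix R d M" and b: "b \<in> V"
    and eq: "\<forall>i\<le>k. mult_mat_vec M (x i) +\<^sub>v b = y i"
    unfolding congruent_simplices_def affine_map_eq_mult_mat_vec by blast
  have "\<forall>i\<le>k. restrict (mult_mat_vec M) V (x i) +\<^sub>v b = y i"
    using eq simplex_vertex_closed [OF x] by simp
  then show "\<exists>g\<in>isometries. maps_edges k g x y"
    using translate_imp_maps_edges [OF x _ b] orthogonal_matrix_isometry [OF M] by blast
next
  assume "\<exists>g\<in>isometries. maps_edges k g x y"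
  then obtain g where g: "g \<in> isometries" "maps_edges k g x y"
    by blast
  obtain M where M: "orthogonal_matrix R d M" "\<And>x. x \<in> V \<Longrightarrow> mult_mat_vec M x = g x"
    using isometry_orthogonal_matrix [OF g(1)] by blast
  have "\<forall>i\<le>k. affine_map R d M (y 0 -\<^sub>v g (x 0)) (x i) = y i"
    using maps_edges_imp_translate [OF x y g] simplex_vertex_closed [OF x]
    by (simp add: affine_map_eq_mult_mat_vec M)
  moreover have "y 0 -\<^sub>v g (x 0) \<in> V"
    using simplex_vertex_closed [OF x] simplex_vertex_closed [OF y] g(1) by simp
  ultimately show "congruent_simplices R d k x y"
    unfolding congruent_simplices_def using M(1) by blast
qed

lemma maps_edges_one: "x \<in> simplices k V \<Longrightarrow> maps_edges k \<one>\<^bsub>orthogonal_group\<^esub> x x"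
  by (simp add: simplex_vertex_closed flip: orthogonal.id_eq_one)

lemma maps_edges_inv:
  "x \<in> simplices k V \<Longrightarrow> g \<in> isometries \<Longrightarrow> maps_edges k g x y \<Longrightarrow>
    maps_edges k (inv\<^bsub>orthogonal_group\<^esub> g) y x"
  using orthogonal.orbit_sym_aux [of g] by (simp add: simplex_vertex_closed)

lemma maps_edges_mult:
  "x \<in> simplices k V \<Longrightarrow> g \<in> isometries \<Longrightarrow> h \<in> isometries \<Longrightarrow> maps_edges k g x y \<Longrightarrow>
    maps_edges k h y z \<Longrightarrow> maps_edges k (h \<otimes>\<^bsub>orthogonal_group\<^esub> g) x z"
  using orthogonal.composition_rule [of _ h g] by (simp add: simplex_vertex_closed)

definition congruence :: "nat \<Rightarrow> (nat \<Rightarrow> 'a) set \<Rightarrow> ((nat \<Rightarrow> nat \<Rightarrow> 'a) \<times> (nat \<Rightarrow> nat \<Rightarrow> 'a)) set" where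
  "congruence k E =
     {(x, y). x \<in> simplices k E \<and> y \<in> simplices k E \<and> congruent_simplices R d k x y}"

lemma mem_congruence_iff:
  assumes "E \<subseteq> V"
  shows "(x, y) \<in> congruence k E \<longleftrightarrow>
    x \<in> simplices k E \<and> y \<in> simplices k E \<and> (\<exists>g\<in>isometries. maps_edges k g x y)"
  using congruent_simplices_iff_maps_edges simplices_mono [OF assms]
  unfolding congruence_def by blast

lemma equiv_congruence:
  assumes E: "E \<subseteq> V"
  shows "equiv (simplices k E) (congruence k E)"
proof (rule equivI)
  have V: "x \<in> simplices k V" if "x \<in> simplices k E" for x
    using that simplices_mono [OF E] by blast
  show "congruence k E \<subseteq> simplices k E \<times> simplices k E"
    by (auto simp: congruence_def)
  show "refl_on (simplices k E) (congruence k E)"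
    using maps_edges_one V one_isometry unfolding refl_on_def mem_congruence_iff [OF E] by blast
  show "sym (congruence k E)"
    using maps_edges_inv V inv_isometry unfolding sym_def mem_congruence_iff [OF E] by blast
  show "trans (congruence k E)"
    using maps_edges_mult V mult_isometry unfolding trans_def mem_congruence_iff [OF E] by blast
qed

section \<open>Pointwise stabilizers in the orthogonal group\<close>

abbreviation fixer :: "(nat \<Rightarrow> 'a) set \<Rightarrow> ((nat \<Rightarrow> 'a) \<Rightarrow> nat \<Rightarrow> 'a) set" where
  "fixer \<equiv> orthogonal.pointwise_stabilizer"

definition perp :: "(nat \<Rightarrow> 'a) set \<Rightarrow> (nat \<Rightarrow> 'a) set" where
  "perp A = {w \<in> V. \<forall>z\<in>A. w \<bullet> z = \<zero>}"

definition perp_coset :: "(nat \<Rightarrow> 'a) set \<Rightarrow> (nat \<Rightarrow> 'a) \<Rightarrow> (nat \<Rightarrow> 'a) set" where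
  "perp_coset A x = {y \<in> V. \<forall>z\<in>A. y \<bullet> z = x \<bullet> z}"

lemma perp_subset_V: "perp A \<subseteq> V"
  and perp_coset_subset_V: "perp_coset A x \<subseteq> V"
  by (auto simp: perp_def perp_coset_def)

lemma finite_perp [simp]: "finite (perp A)"
  and finite_perp_coset [simp]: "finite (perp_coset A x)"
  by (simp_all add: finite_subset_V perp_subset_V perp_coset_subset_V)

lemma perp_insert: "perp (insert x A) = {w \<in> perp A. w \<bullet> x = \<zero>}"
  by (auto simp: perp_def)

lemma perp_add_smult:
  "A \<subseteq> V \<Longrightarrow> w \<in> perp A \<Longrightarrow> u \<in> perp A \<Longrightarrow> t \<in> carrier R \<Longrightarrow> w +\<^sub>v t \<cdot>\<^sub>v u \<in> perp A"
  by (simp add: perp_def subset_iff dot_add_left dot_smult_left)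

lemma perp_coset_add_smult:
  "A \<subseteq> V \<Longrightarrow> x \<in> V \<Longrightarrow> y \<in> perp_coset A x \<Longrightarrow> u \<in> perp A \<Longrightarrow> t \<in> carrier R \<Longrightarrow>
    y +\<^sub>v t \<cdot>\<^sub>v u \<in> perp_coset A x"
  by (simp add: perp_def perp_coset_def subset_iff dot_add_left dot_smult_left)

lemma minus_mem_perp:
  "A \<subseteq> V \<Longrightarrow> x \<in> V \<Longrightarrow> y \<in> perp_coset A x \<Longrightarrow> y -\<^sub>v x \<in> perp A"
  by (simp add: perp_def perp_coset_def subset_iff dot_minus_left)

lemma card_perp_coset:
  assumes A: "A \<subseteq> V" and x: "x \<in> V"
  shows "card (perp_coset A x) = card (perp A)"
proof -
  have "bij_betw (\<lambda>y. y -\<^sub>v x) (perp_coset A x) (perp A)"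
  proof (rule bij_betw_byWitness [where f' = "\<lambda>w. w +\<^sub>v x"])
    show "(\<lambda>y. y -\<^sub>v x) ` perp_coset A x \<subseteq> perp A"
      using minus_mem_perp [OF A x] by blast
    show "(\<lambda>w. w +\<^sub>v x) ` perp A \<subseteq> perp_coset A x"
      using A x by (auto simp: perp_def perp_coset_def subset_iff dot_add_left)
  qed (use x in \<open>simp_all add: perp_def perp_coset_def\<close>)
  then show ?thesis
    by (rule bij_betw_same_card)
qed

lemma sum_card_line_inter:
  assumes W: "W \<subseteq> V" "\<And>w t. w \<in> W \<Longrightarrow> t \<in> carrier R \<Longrightarrow> w +\<^sub>v t \<cdot>\<^sub>v u \<in> W"
    and u: "u \<in> V" and S: "S \<subseteq> W"
  shows "(\<Sum>w\<in>W. card {t \<in> carrier R. w +\<^sub>v t \<cdot>\<^sub>v u \<in> S}) = order R * card S"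
proof -
  have "card {w \<in> W. w +\<^sub>v t \<cdot>\<^sub>v u \<in> S} = card S" if t: "t \<in> carrier R" for t
  proof -
    have cancel: "w +\<^sub>v t \<cdot>\<^sub>v u +\<^sub>v (\<ominus> t) \<cdot>\<^sub>v u = w" "w +\<^sub>v (\<ominus> t) \<cdot>\<^sub>v u +\<^sub>v t \<cdot>\<^sub>v u = w"
      if "w \<in> W" for w
      using that W(1) u t
      by (simp_all add: subset_iff vec.M.a_assoc vec.smult_l_minus vec.M.r_neg vec.M.l_neg)
    have "bij_betw (\<lambda>w. w +\<^sub>v t \<cdot>\<^sub>v u) {w \<in> W. w +\<^sub>v t \<cdot>\<^sub>v u \<in> S} S"
      by (rule bij_betw_byWitness [where f' = "\<lambda>w. w +\<^sub>v (\<ominus> t) \<cdot>\<^sub>v u"])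
        (use W S t in \<open>auto simp: cancel subset_iff\<close>)
    then show ?thesis
      by (rule bij_betw_same_card)
  qed
  then have "(\<Sum>w\<in>W. card {t \<in> carrier R. w +\<^sub>v t \<cdot>\<^sub>v u \<in> S}) = (\<Sum>t\<in>carrier R. card S)"
    using finite_subset_V [OF W(1)] finite_carrier by (intro sum_multicount_gen) auto
  then show ?thesis
    by (simp add: order_def)
qed

lemma fixer_orbit_subset:
  assumes A: "A \<subseteq> V" and x: "x \<in> V"
  shows "(\<lambda>g. g x) ` fixer A \<subseteq> {y \<in> perp_coset A x. y \<bullet> y = x \<bullet> x}"
proof (rule image_subsetI)
  fix g assume "g \<in> fixer A"
  then have g: "g \<in> isometries" "\<And>z. z \<in> A \<Longrightarrow> g z = z"
    by (simp_all add: orthogonal.pointwise_stabilizer_def)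
  have "g x \<bullet> z = x \<bullet> z" if "z \<in> A" for z
    using isometry_dot [OF g(1) x, of z] g(2) [OF that] A that by auto
  then show "g x \<in> {y \<in> perp_coset A x. y \<bullet> y = x \<bullet> x}"
    using g(1) x by (simp add: perp_coset_def)
qed

text \<open>For \<open>g\<close> in the stabilizer and any \<open>u\<close>, the vector \<open>g u - u\<close> is orthogonal to \<open>A\<close>; this
  replaces a dimension count.\<close>

lemma fixer_fixes_double_perp:
  assumes A: "A \<subseteq> V" and x: "x \<in> V" and perp: "\<And>w. w \<in> perp A \<Longrightarrow> w \<bullet> x = \<zero>"
    and g: "g \<in> fixer A"
  shows "g x = x"
proof -
  have iso: "g \<in> isometries"
    using g by (simp add: orthogonal.pointwise_stabilizer_def)
  have "g x \<bullet> g u = x \<bullet> g u" if u: "u \<in> V" for u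
  proof -
    have gu: "g u \<in> perp_coset A u"
      using fixer_orbit_subset [OF A u] g by blast
    have "g u \<bullet> x \<ominus> u \<bullet> x = (g u -\<^sub>v u) \<bullet> x"
      using iso u x by (simp add: dot_minus_left)
    also have "\<dots> = \<zero>"
      by (rule perp [OF minus_mem_perp [OF A u gu]])
    finally have "g u \<bullet> x = u \<bullet> x"
      using iso u x by simp
    then show ?thesis
      using iso u x by (simp add: dot_commute [of x])
  qed
  then show ?thesis
    by (rule isometry_nondegenerate [OF iso isometry_closed [OF iso x] x])
qed

end

locale finite_field_space = finite_coordinate_space R d + field R for R (structure) and d
begin

lemma dot_surjective:
  assumes y: "y \<in> V" "y \<noteq> \<zero>\<^sub>v" and a: "a \<in> carrier R"
  shows "\<exists>x\<in>V. x \<bullet> y = a"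
proof -
  obtain j where j: "j < d" "y j \<noteq> \<zero>"
    using y vec_eqI [of y "\<zero>\<^sub>v"] by auto
  then have unit: "y j \<in> Units R"
    using y(1) by (simp add: field_Units)
  have "((a \<otimes> inv (y j)) \<cdot>\<^sub>v unit_vec j) \<bullet> y = a"
    using a j y(1) unit by (simp add: dot_smult_left dot_commute [of "unit_vec j"] m_assoc)
  then show ?thesis
    using a unit by (intro bexI [of _ "(a \<otimes> inv (y j)) \<cdot>\<^sub>v unit_vec j"]) auto
qed

lemma card_perp_insert:
  assumes A: "A \<subseteq> V" and x: "x \<in> V" and v: "v \<in> perp A" "v \<bullet> x \<noteq> \<zero>"
  shows "card (perp A) = order R * card (perp (insert x A))"
proof -
  have vV: "v \<in> V"
    using v(1) perp_subset_V by blast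
  have "card {t \<in> carrier R. w +\<^sub>v t \<cdot>\<^sub>v v \<in> perp (insert x A)} = 1" if w: "w \<in> perp A" for w
  proof -
    have wV: "w \<in> V"
      using w perp_subset_V by blast
    have "{t \<in> carrier R. w +\<^sub>v t \<cdot>\<^sub>v v \<in> perp (insert x A)} =
        {t \<in> carrier R. (v \<bullet> x) \<otimes> t \<oplus> w \<bullet> x = \<zero>}"
      using perp_add_smult [OF A w v(1)] wV vV x
      by (auto simp: perp_insert dot_add_left dot_smult_left m_comm a_comm)
    then show ?thesis
      using v(2) wV vV x by (simp add: card_linear_roots)
  qed
  then have "(\<Sum>w\<in>perp A. card {t \<in> carrier R. w +\<^sub>v t \<cdot>\<^sub>v v \<in> perp (insert x A)}) = card (perp A)"
    by simp
  moreover have "(\<Sum>w\<in>perp A. card {t \<in> carrier R. w +\<^sub>v t \<cdot>\<^sub>v v \<in> perp (insert x A)}) =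
      order R * card (perp (insert x A))"
    using perp_add_smult [OF A _ v(1)] vV perp_subset_V
    by (intro sum_card_line_inter) (auto simp: perp_insert)
  ultimately show ?thesis
    by simp
qed

text \<open>Along a line in direction \<open>u\<close> the equation \<open>y \<bullet> y = x \<bullet> x\<close> is quadratic with leading
  coefficients \<open>u \<bullet> u\<close> and \<open>2 (y \<bullet> u)\<close>; if \<open>perp A\<close> is totally isotropic, the latter does not vanish
  for \<open>u = v\<close>.\<close>

lemma exists_transversal_direction:
  assumes odd: "odd (order R)" and A: "A \<subseteq> V" and x: "x \<in> V" and v: "v \<in> perp A" "v \<bullet> x \<noteq> \<zero>"
  obtains u where "u \<in> perp A" "\<And>y. y \<in> perp_coset A x \<Longrightarrow> u \<bullet> u \<noteq> \<zero> \<or> y \<bullet> u \<oplus> y \<bullet> u \<noteq> \<zero>"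
proof (cases "\<exists>u\<in>perp A. u \<bullet> u \<noteq> \<zero>")
  case True
  then show ?thesis
    using that by blast
next
  case False
  have vV: "v \<in> V"
    using v(1) perp_subset_V by blast
  have "y \<bullet> v \<oplus> y \<bullet> v \<noteq> \<zero>" if y: "y \<in> perp_coset A x" for y
  proof -
    define w where "w = y -\<^sub>v x"
    have yV: "y \<in> V"
      using y perp_coset_subset_V by blast
    then have wV: "w \<in> V"
      using x by (simp add: w_def)
    have w: "w \<in> perp A"
      using minus_mem_perp [OF A x y] by (simp add: w_def)
    have "w +\<^sub>v v \<in> perp A"
      using perp_add_smult [OF A w v(1) one_closed] vV by simp
    have "w \<bullet> v \<oplus> w \<bullet> v = (w \<bullet> w \<oplus> w \<bullet> v) \<oplus> (w \<bullet> v \<oplus> v \<bullet> v)"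
      using False w v(1) wV vV by simp
    also have "\<dots> = (w +\<^sub>v v) \<bullet> (w +\<^sub>v v)"
      using wV vV by (simp add: dot_add_left dot_add_right dot_commute [of v w])
    also have "\<dots> = \<zero>"
      using False \<open>w +\<^sub>v v \<in> perp A\<close> by simp
    finally have "w \<bullet> v = \<zero>"
      by (rule double_eq_zero_imp_eq_zero [OF odd dot_closed [OF wV vV]])
    then have "y \<bullet> v = v \<bullet> x"
      using yV x vV by (simp add: w_def dot_minus_left dot_commute [of v])
    then show ?thesis
      using v(2) double_eq_zero_imp_eq_zero [OF odd, of "v \<bullet> x"] vV x by auto
  qed
  then show ?thesis
    using that v(1) by blast
qed

lemma card_perp_coset_sphere_le:
  assumes odd: "odd (order R)" and A: "A \<subseteq> V" and x: "x \<in> V" and v: "v \<in> perp A" "v \<bullet> x \<noteq> \<zero>"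
  shows "order R * card {y \<in> perp_coset A x. y \<bullet> y = x \<bullet> x} \<le> 2 * card (perp A)"
    (is "_ * card ?S \<le> _")
proof -
  obtain u where u: "u \<in> perp A"
    and transversal: "\<And>y. y \<in> perp_coset A x \<Longrightarrow> u \<bullet> u \<noteq> \<zero> \<or> y \<bullet> u \<oplus> y \<bullet> u \<noteq> \<zero>"
    using exists_transversal_direction [OF assms] by blast
  have uV: "u \<in> V"
    using u perp_subset_V by blast
  have "card {t \<in> carrier R. y +\<^sub>v t \<cdot>\<^sub>v u \<in> ?S} \<le> 2" if y: "y \<in> perp_coset A x" for y
  proof -
    have yV: "y \<in> V"
      using y perp_coset_subset_V by blast
    have "{t \<in> carrier R. y +\<^sub>v t \<cdot>\<^sub>v u \<in> ?S} \<subseteq>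
        {t \<in> carrier R. (u \<bullet> u) \<otimes> t \<otimes> t \<oplus> (y \<bullet> u \<oplus> y \<bullet> u) \<otimes> t \<oplus> (y \<bullet> y \<ominus> x \<bullet> x) = \<zero>}"
      using x yV uV by (auto simp: dot_self_add_smult minus_eq r_neg simp flip: a_assoc)
    then have "card {t \<in> carrier R. y +\<^sub>v t \<cdot>\<^sub>v u \<in> ?S} \<le>
        card {t \<in> carrier R. (u \<bullet> u) \<otimes> t \<otimes> t \<oplus> (y \<bullet> u \<oplus> y \<bullet> u) \<otimes> t \<oplus> (y \<bullet> y \<ominus> x \<bullet> x) = \<zero>}"
      using finite_carrier by (intro card_mono) auto
    also have "\<dots> \<le> 2"
      using transversal [OF y] x yV uV by (intro card_quadratic_roots_le) simp_all
    finally show ?thesis .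
  qed
  then have "(\<Sum>y\<in>perp_coset A x. card {t \<in> carrier R. y +\<^sub>v t \<cdot>\<^sub>v u \<in> ?S}) \<le>
      (\<Sum>y\<in>perp_coset A x. 2)"
    by (rule sum_mono)
  moreover have "(\<Sum>y\<in>perp_coset A x. card {t \<in> carrier R. y +\<^sub>v t \<cdot>\<^sub>v u \<in> ?S}) = order R * card ?S"
    using perp_coset_add_smult [OF A x _ u]
    by (intro sum_card_line_inter perp_coset_subset_V uV) auto
  ultimately show ?thesis
    by (simp add: card_perp_coset [OF A x] mult.commute)
qed

lemma card_fixer_le_insert:
  assumes odd: "odd (order R)" and A: "A \<subseteq> V" and x: "x \<in> V" and v: "v \<in> perp A" "v \<bullet> x \<noteq> \<zero>"
  shows "card (fixer A) \<le> 2 * card (perp (insert x A)) * card (fixer (insert x A))"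
proof -
  have "order R * card ((\<lambda>g. g x) ` fixer A) \<le> order R * card {y \<in> perp_coset A x. y \<bullet> y = x \<bullet> x}"
    by (intro mult_le_mono2 card_mono fixer_orbit_subset [OF A x]) simp
  also have "\<dots> \<le> order R * (2 * card (perp (insert x A)))"
    using card_perp_coset_sphere_le [OF assms] card_perp_insert [OF A x v] by simp
  finally have "card ((\<lambda>g. g x) ` fixer A) \<le> 2 * card (perp (insert x A))"
    using order_pos by simp
  then show ?thesis
    unfolding orthogonal.card_pointwise_stabilizer_insert [OF A x] by (rule mult_le_mono1)
qed

lemma card_perp_insert_power:
  assumes A: "A \<subseteq> V" and x: "x \<in> V" and v: "v \<in> perp A" "v \<bullet> x \<noteq> \<zero>"
    and r: "r \<le> d" "card (perp A) = order R ^ (d - r)"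
  shows "r < d" "card (perp (insert x A)) = order R ^ (d - Suc r)"
proof -
  have card_perp: "order R * card (perp (insert x A)) = order R ^ (d - r)"
    using card_perp_insert [OF A x v] r(2) by simp
  have "order R \<noteq> 1"
    using one_not_zero zero_closed one_closed unfolding order_def
    by (metis card_1_singletonE singletonD)
  then show "r < d"
    using card_perp r(1) by (cases "r = d") auto
  then show "card (perp (insert x A)) = order R ^ (d - Suc r)"
    using card_perp order_pos by (simp add: Suc_diff_Suc [symmetric])
qed

text \<open>Here \<open>r\<close> is the rank of \<open>A\<close>.\<close>

lemma card_isometries_le_fixer_rank:
  assumes odd: "odd (order R)" and "finite A" "A \<subseteq> V"
  shows "\<exists>r\<le>card A. r \<le> d \<and> card (perp A) = order R ^ (d - r) \<and>
    card isometries \<le> card (fixer A) * (\<Prod>j<r. 2 * order R ^ (d - Suc j))"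
  using assms(2,3)
proof (induction A)
  case empty
  have "perp {} = V"
    by (auto simp: perp_def)
  then show ?case
    by (intro exI [of _ 0]) (simp add: card_V orthogonal.pointwise_stabilizer_empty)
next
  case (insert x A)
  then obtain r where r: "r \<le> card A" "r \<le> d" "card (perp A) = order R ^ (d - r)"
    "card isometries \<le> card (fixer A) * (\<Prod>j<r. 2 * order R ^ (d - Suc j))"
    by auto
  have A: "A \<subseteq> V" and x: "x \<in> V"
    using insert.prems by auto
  show ?case
  proof (cases "\<exists>v\<in>perp A. v \<bullet> x \<noteq> \<zero>")
    case False
    then have "perp (insert x A) = perp A"
      by (auto simp: perp_insert)
    moreover have "fixer (insert x A) = fixer A"
      using False fixer_fixes_double_perp [OF A x]
      by (auto simp: orthogonal.pointwise_stabilizer_insert)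
    ultimately show ?thesis
      using r insert.hyps by (intro exI [of _ r]) auto
  next
    case True
    then obtain v where v: "v \<in> perp A" "v \<bullet> x \<noteq> \<zero>"
      by blast
    note insert_power = card_perp_insert_power [OF A x v r(2,3)]
    have "card isometries \<le> (2 * order R ^ (d - Suc r) * card (fixer (insert x A))) *
        (\<Prod>j<r. 2 * order R ^ (d - Suc j))"
      using r(4) card_fixer_le_insert [OF odd A x v] unfolding insert_power(2)
      by (meson mult_le_mono1 order_trans)
    also have "\<dots> = card (fixer (insert x A)) * (\<Prod>j<Suc r. 2 * order R ^ (d - Suc j))"
      by (simp add: mult_ac)
    finally show ?thesis
      using r(1) insert_power insert.hyps by (intro exI [of _ "Suc r"]) auto
  qed
qed

lemma card_isometries_le_fixer:
  assumes odd: "odd (order R)" and A: "finite A" "A \<subseteq> V" "card A \<le> k" and k: "k \<le> d"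
  shows "card isometries \<le> card (fixer A) * (2 ^ k * order R ^ (k * d - ((k + 1) choose 2)))"
proof -
  obtain r where r: "r \<le> card A"
    "card isometries \<le> card (fixer A) * (\<Prod>j<r. 2 * order R ^ (d - Suc j))"
    using card_isometries_le_fixer_rank [OF odd A(1,2)] by blast
  have "(\<Prod>j<r. 2 * order R ^ (d - Suc j)) \<le> (\<Prod>j<k. 2 * order R ^ (d - Suc j))"
    using r(1) A(3) order_pos by (intro dvd_imp_le prod_dvd_prod_subset) auto
  also have "\<dots> = 2 ^ k * order R ^ (\<Sum>j<k. d - Suc j)"
    by (simp add: prod.distrib power_sum)
  also have "(\<Sum>j<k. d - Suc j) = k * d - ((k + 1) choose 2)"
    using sum_diff_Suc_add_choose_two [OF k] by simp
  finally show ?thesis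
    using r(2) by (meson mult_le_mono2 order_trans)
qed

end

section \<open>Differences and congruent pairs\<close>

context finite_coordinate_space
begin

definition difference_count ::
    "(nat \<Rightarrow> 'a) set \<Rightarrow> (nat \<Rightarrow> 'a) set \<Rightarrow> (nat \<Rightarrow> 'a) \<Rightarrow> nat" where
  "difference_count A B b = card {u \<in> A. u +\<^sub>v b \<in> B}"

lemma difference_count_le_card: "A \<subseteq> V \<Longrightarrow> difference_count A B b \<le> card A"
  unfolding difference_count_def by (intro card_mono finite_subset_V) auto

lemma bij_betw_differences:
  assumes "u \<in> V" "B \<subseteq> V"
  shows "bij_betw (\<lambda>v. v -\<^sub>v u) B {b \<in> V. u +\<^sub>v b \<in> B}"
  by (rule bij_betw_byWitness [where f' = "\<lambda>b. u +\<^sub>v b"])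
    (use assms in \<open>auto simp: subset_iff vec.M.a_comm [of u]\<close>)

lemma sum_difference_count:
  assumes A: "A \<subseteq> V" and B: "B \<subseteq> V"
  shows "(\<Sum>b\<in>V. difference_count A B b) = card A * card B"
proof -
  have "card {b \<in> V. u +\<^sub>v b \<in> B} = card B" if "u \<in> A" for u
    using bij_betw_same_card [OF bij_betw_differences [OF _ B]] that A by auto
  then have "(\<Sum>b\<in>V. difference_count A B b) = (\<Sum>u\<in>A. card B)"
    unfolding difference_count_def using finite_subset_V [OF A] by (intro sum_multicount_gen) auto
  then show ?thesis
    by simp
qed

lemma card_translated_pairs_le:
  assumes E: "E \<subseteq> V" and g: "g \<in> isometries"
  shows "card {(x, y) \<in> simplices k E \<times> simplices k E. \<forall>i\<le>k. g (x i) +\<^sub>v b = y i} \<le>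
    difference_count (g ` E) E b ^ (k + 1)" (is "card ?P \<le> _")
proof -
  let ?S = "{u \<in> g ` E. u +\<^sub>v b \<in> E}"
  let ?f = "\<lambda>(x, y). \<lambda>i\<in>{..k}. g (x i)"
  have "card ?P \<le> card (simplices k ?S)"
  proof (rule card_inj_on_le [where f = ?f])
    show "?f ` ?P \<subseteq> simplices k ?S"
      by (auto simp: simplices_def PiE_iff)
    show "inj_on ?f ?P"
    proof (rule inj_onI, clarify)
      fix x y x' y'
      assume simplices: "x \<in> simplices k E" "y \<in> simplices k E"
          "x' \<in> simplices k E" "y' \<in> simplices k E"
        and y: "\<forall>i\<le>k. g (x i) +\<^sub>v b = y i" "\<forall>i\<le>k. g (x' i) +\<^sub>v b = y' i"
        and eq: "(\<lambda>i\<in>{..k}. g (x i)) = (\<lambda>i\<in>{..k}. g (x' i))"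
      have gx: "g (x i) = g (x' i)" if "i \<le> k" for i
        using fun_cong [OF eq, of i] that by simp
      have "x i = x' i" if "i \<le> k" for i
        using bij_betw_isometry [OF g] gx [OF that] simplex_vertex_closed simplices(1,3) that E
        by (meson bij_betw_def inj_onD subsetD)
      moreover have "y i = y' i" if "i \<le> k" for i
        using gx y that by metis
      ultimately show "x = x' \<and> y = y'"
        using simplex_eqI [OF simplices(1,3)] simplex_eqI [OF simplices(2,4)] by blast
    qed
    show "finite (simplices k ?S)"
      using finite_subset_V [OF E] by (simp add: finite_simplices)
  qed
  then show ?thesis
    by (simp add: simplices_def card_PiE difference_count_def)
qed

lemma card_maps_edges_pairs_le:
  assumes E: "E \<subseteq> V" and g: "g \<in> isometries"
  shows "card {(x, y) \<in> simplices k E \<times> simplices k E. maps_edges k g x y} \<le>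
    (\<Sum>b\<in>V. difference_count (g ` E) E b ^ (k + 1))" (is "card ?P \<le> _")
proof -
  let ?Q = "\<lambda>b. {(x, y) \<in> simplices k E \<times> simplices k E. \<forall>i\<le>k. g (x i) +\<^sub>v b = y i}"
  have "?P \<subseteq> (\<Union>b\<in>V. ?Q b)"
  proof clarify
    fix x y assume xy: "x \<in> simplices k E" "y \<in> simplices k E" "maps_edges k g x y"
    then have V: "x \<in> simplices k V" "y \<in> simplices k V"
      using simplices_mono [OF E] by auto
    then have "y 0 -\<^sub>v g (x 0) \<in> V"
      using g by (simp add: simplex_vertex_closed)
    moreover have "\<forall>i\<le>k. g (x i) +\<^sub>v (y 0 -\<^sub>v g (x 0)) = y i"
      using maps_edges_imp_translate [OF V g xy(3)] by blast
    ultimately show "(x, y) \<in> (\<Union>b\<in>V. ?Q b)"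
      using xy by blast
  qed
  moreover have "finite (simplices k E \<times> simplices k E)"
    by (simp add: finite_simplices [OF finite_subset_V [OF E]])
  ultimately have "card ?P \<le> card (\<Union>b\<in>V. ?Q b)"
    by (intro card_mono) (auto intro: finite_subset [of _ "simplices k E \<times> simplices k E"])
  also have "\<dots> \<le> (\<Sum>b\<in>V. card (?Q b))"
    by (rule card_UN_le) simp
  also have "\<dots> \<le> (\<Sum>b\<in>V. difference_count (g ` E) E b ^ (k + 1))"
    by (intro sum_mono card_translated_pairs_le [OF E g])
  finally show ?thesis .
qed

end

context finite_field_space
begin

lemma card_isometries_le_matching:
  assumes odd: "odd (order R)" and k: "k \<le> d" and E: "E \<subseteq> V" and xy: "(x, y) \<in> congruence k E"
  shows "card isometries \<le> card {g \<in> isometries. maps_edges k g x y} *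
    (2 ^ k * order R ^ (k * d - ((k + 1) choose 2)))"
proof -
  obtain h where h: "h \<in> isometries" "maps_edges k h x y"
    using xy unfolding mem_congruence_iff [OF E] by blast
  define A where "A = (\<lambda>i. x i -\<^sub>v x 0) ` {1..k}"
  have vertex: "x i \<in> V" if "i \<le> k" for i
    using xy that E simplex_vertex_closed unfolding mem_congruence_iff [OF E] by blast
  have A: "finite A" "A \<subseteq> V" "card A \<le> k"
    using vertex card_image_le [of "{1..k}" "\<lambda>i. x i -\<^sub>v x 0"] by (auto simp: A_def)
  have "{g \<in> isometries. maps_edges k g x y} = {g \<in> isometries. \<forall>v\<in>A. g v = h v}"
    using h(2) by (auto simp: A_def)
  then have "card {g \<in> isometries. maps_edges k g x y} = card (fixer A)"
    using orthogonal.card_agreeing_eq_pointwise_stabilizer [OF A(2) h(1)] by simp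
  then show ?thesis
    using card_isometries_le_fixer [OF odd A k] by simp
qed

lemma card_congruence_le:
  assumes odd: "odd (order R)" and k: "k \<le> d" and E: "E \<subseteq> V"
  shows "card (congruence k E) * card isometries \<le>
    2 ^ k * order R ^ (k * d - ((k + 1) choose 2)) *
      (\<Sum>g\<in>isometries. \<Sum>b\<in>V. difference_count (g ` E) E b ^ (k + 1))" (is "_ \<le> ?B * _")
proof -
  let ?match = "\<lambda>g (x, y). maps_edges k g x y"
  have finite_pairs: "finite (simplices k E \<times> simplices k E)"
    by (simp add: finite_simplices [OF finite_subset_V [OF E]])
  have subset_pairs: "congruence k E \<subseteq> simplices k E \<times> simplices k E"
    by (auto simp: congruence_def)
  have "card (congruence k E) * card isometries = (\<Sum>p\<in>congruence k E. card isometries)"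
    by simp
  also have "\<dots> \<le> (\<Sum>p\<in>congruence k E. card {g \<in> isometries. ?match g p} * ?B)"
    using card_isometries_le_matching [OF odd k E] by (intro sum_mono) auto
  also have "\<dots> = ?B * (\<Sum>p\<in>congruence k E. card {g \<in> isometries. ?match g p})"
    by (simp add: sum_distrib_left mult.commute)
  also have "(\<Sum>p\<in>congruence k E. card {g \<in> isometries. ?match g p}) =
      (\<Sum>g\<in>isometries. card {p \<in> congruence k E. ?match g p})"
    using finite_subset [OF subset_pairs finite_pairs] by (intro sum_multicount_gen) auto
  also have "\<dots> \<le> (\<Sum>g\<in>isometries. \<Sum>b\<in>V. difference_count (g ` E) E b ^ (k + 1))"
  proof (rule sum_mono)
    fix g assume g: "g \<in> isometries"
    have "card {p \<in> congruence k E. ?match g p} \<le>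
        card {p \<in> simplices k E \<times> simplices k E. ?match g p}"
      using subset_pairs finite_pairs by (intro card_mono) auto
    also have "\<dots> \<le> (\<Sum>b\<in>V. difference_count (g ` E) E b ^ (k + 1))"
      using card_maps_edges_pairs_le [OF E g, of k]
      by (simp add: case_prod_unfold mem_Times_iff conj_assoc)
    finally show "card {p \<in> congruence k E. ?match g p} \<le>
        (\<Sum>b\<in>V. difference_count (g ` E) E b ^ (k + 1))" .
  qed
  finally show ?thesis
    by simp
qed

end

section \<open>Fourier analysis\<close>

locale finite_field_character = finite_field_space R d for R (structure) and d +
  fixes \<chi> :: "'a \<Rightarrow> complex"
  assumes character: "nontrivial_additive_character R \<chi>"
begin

lemma norm_character [simp]: "a \<in> carrier R \<Longrightarrow> cmod (\<chi> a) = 1"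
  and character_add: "a \<in> carrier R \<Longrightarrow> b \<in> carrier R \<Longrightarrow> \<chi> (a \<oplus> b) = \<chi> a * \<chi> b"
  and character_nontrivial: "\<exists>a\<in>carrier R. \<chi> a \<noteq> 1"
  using character by (auto simp: nontrivial_additive_character_def)

lemma character_zero [simp]: "\<chi> \<zero> = 1"
proof -
  have "\<chi> \<zero> \<noteq> 0"
    by (metis norm_character norm_zero zero_closed zero_neq_one)
  then show ?thesis
    using character_add [of \<zero> \<zero>] by simp
qed

lemma character_uminus:
  assumes a: "a \<in> carrier R"
  shows "\<chi> (\<ominus> a) = cnj (\<chi> a)"
proof -
  have "\<chi> a * \<chi> (\<ominus> a) = \<chi> a * cnj (\<chi> a)"
    using a character_add [of a "\<ominus> a"] by (simp add: r_neg flip: complex_norm_square)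
  moreover have "\<chi> a \<noteq> 0"
    using norm_character [OF a] by auto
  ultimately show ?thesis
    by simp
qed

lemma sum_character_dot:
  assumes y: "y \<in> V"
  shows "(\<Sum>x\<in>V. \<chi> (x \<bullet> y)) = (if y = \<zero>\<^sub>v then of_nat (order R ^ d) else 0)"
proof (cases "y = \<zero>\<^sub>v")
  case True
  then show ?thesis
    by (simp add: card_V)
next
  case False
  obtain a where a: "a \<in> carrier R" "\<chi> a \<noteq> 1"
    using character_nontrivial by blast
  obtain u where u: "u \<in> V" "u \<bullet> y = a"
    using dot_surjective [OF y False a(1)] by blast
  have "bij_betw (\<lambda>x. x +\<^sub>v u) V V"
    by (rule bij_betw_byWitness [where f' = "\<lambda>x. x -\<^sub>v u"]) (use u in auto)
  then have "(\<Sum>x\<in>V. \<chi> (x \<bullet> y)) = (\<Sum>x\<in>V. \<chi> ((x +\<^sub>v u) \<bullet> y))"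
    by (rule sum.reindex_bij_betw [symmetric])
  also have "\<dots> = (\<Sum>x\<in>V. \<chi> (x \<bullet> y)) * \<chi> a"
    unfolding sum_distrib_right using u y
    by (intro sum.cong) (simp_all add: dot_add_left character_add flip: u(2))
  finally show ?thesis
    using False a(2) by simp
qed

lemma sum_character_orthogonal:
  assumes b: "b \<in> V" and c: "c \<in> V"
  shows "(\<Sum>x\<in>V. \<chi> (\<ominus> (x \<bullet> b)) * cnj (\<chi> (\<ominus> (x \<bullet> c)))) =
    (if b = c then of_nat (order R ^ d) else 0)"
proof -
  have "\<chi> (\<ominus> (x \<bullet> b)) * cnj (\<chi> (\<ominus> (x \<bullet> c))) = \<chi> (x \<bullet> (c -\<^sub>v b))" if "x \<in> V" for x
    using that b c by (simp add: dot_minus_right minus_eq character_add character_uminus)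
  then have "(\<Sum>x\<in>V. \<chi> (\<ominus> (x \<bullet> b)) * cnj (\<chi> (\<ominus> (x \<bullet> c)))) = (\<Sum>x\<in>V. \<chi> (x \<bullet> (c -\<^sub>v b)))"
    by simp
  moreover have "c -\<^sub>v b = \<zero>\<^sub>v \<longleftrightarrow> b = c"
    using b c minus_vec_add_cancel [of c b] by (auto simp: a_minus_def vec.M.r_neg)
  ultimately show ?thesis
    using b c by (simp add: sum_character_dot)
qed

lemma plancherel:
  fixes f :: "(nat \<Rightarrow> 'a) \<Rightarrow> complex"
  shows "(\<Sum>x\<in>V. (cmod (\<Sum>b\<in>V. f b * \<chi> (\<ominus> (x \<bullet> b))))\<^sup>2) =
    real (order R) ^ d * (\<Sum>b\<in>V. (cmod (f b))\<^sup>2)"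
proof -
  let ?e = "\<lambda>x b c. \<chi> (\<ominus> (x \<bullet> b)) * cnj (\<chi> (\<ominus> (x \<bullet> c)))"
  have "complex_of_real (\<Sum>x\<in>V. (cmod (\<Sum>b\<in>V. f b * \<chi> (\<ominus> (x \<bullet> b))))\<^sup>2) =
      (\<Sum>x\<in>V. \<Sum>b\<in>V. \<Sum>c\<in>V. f b * cnj (f c) * ?e x b c)"
    by (simp add: complex_norm_square sum_product cnj_sum mult_ac del: of_real_power)
  also have "\<dots> = (\<Sum>b\<in>V. \<Sum>x\<in>V. \<Sum>c\<in>V. f b * cnj (f c) * ?e x b c)"
    by (rule sum.swap)
  also have "\<dots> = (\<Sum>b\<in>V. \<Sum>c\<in>V. f b * cnj (f c) * (\<Sum>x\<in>V. ?e x b c))"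
    unfolding sum_distrib_left by (rule sum.cong [OF refl], rule sum.swap)
  also have "\<dots> = (\<Sum>b\<in>V. \<Sum>c\<in>V. if b = c then of_nat (order R ^ d) * (f b * cnj (f b)) else 0)"
    by (intro sum.cong refl) (simp add: sum_character_orthogonal)
  also have "\<dots> = complex_of_real (real (order R) ^ d * (\<Sum>b\<in>V. (cmod (f b))\<^sup>2))"
    unfolding of_real_mult of_real_sum complex_norm_square by (simp add: sum_distrib_left)
  finally show ?thesis
    unfolding of_real_eq_iff .
qed

definition exp_sum :: "(nat \<Rightarrow> 'a) set \<Rightarrow> (nat \<Rightarrow> 'a) \<Rightarrow> complex" where
  "exp_sum E x = (\<Sum>y\<in>E. \<chi> (\<ominus> (x \<bullet> y)))"

lemma exp_sum_zero: "E \<subseteq> V \<Longrightarrow> exp_sum E \<zero>\<^sub>v = of_nat (card E)"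
  by (simp add: exp_sum_def subset_iff cong: sum.cong)

lemma sum_character_differences:
  assumes B: "B \<subseteq> V" and u: "u \<in> V" and x: "x \<in> V"
  shows "(\<Sum>b\<in>{b \<in> V. u +\<^sub>v b \<in> B}. \<chi> (\<ominus> (x \<bullet> b))) = exp_sum B x * cnj (\<chi> (\<ominus> (x \<bullet> u)))"
proof -
  have "\<chi> (\<ominus> (x \<bullet> (v -\<^sub>v u))) = \<chi> (\<ominus> (x \<bullet> v)) * cnj (\<chi> (\<ominus> (x \<bullet> u)))" if "v \<in> B" for v
  proof -
    have "v \<in> V"
      using that B by blast
    then show ?thesis
      using u x by (simp add: dot_minus_right minus_eq minus_add character_add character_uminus)
  qed
  then show ?thesis
    unfolding exp_sum_def sum_distrib_right
    by (simp flip: sum.reindex_bij_betw [OF bij_betw_differences [OF u B]])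
qed

lemma fourier_difference_count:
  assumes A: "A \<subseteq> V" and B: "B \<subseteq> V" and x: "x \<in> V"
  shows "(\<Sum>b\<in>V. of_nat (difference_count A B b) * \<chi> (\<ominus> (x \<bullet> b))) =
    exp_sum B x * cnj (exp_sum A x)"
proof -
  have "(\<Sum>b\<in>V. of_nat (difference_count A B b) * \<chi> (\<ominus> (x \<bullet> b))) =
      (\<Sum>b\<in>V. \<Sum>u\<in>{u \<in> A. u +\<^sub>v b \<in> B}. \<chi> (\<ominus> (x \<bullet> b)))"
    by (simp add: difference_count_def)
  also have "\<dots> = (\<Sum>u\<in>A. \<Sum>b\<in>{b \<in> V. u +\<^sub>v b \<in> B}. \<chi> (\<ominus> (x \<bullet> b)))"
    by (rule sum.swap_restrict) (auto simp: finite_subset_V [OF A])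
  also have "\<dots> = (\<Sum>u\<in>A. exp_sum B x * cnj (\<chi> (\<ominus> (x \<bullet> u))))"
    using A by (intro sum.cong refl sum_character_differences B x) blast
  also have "\<dots> = exp_sum B x * cnj (exp_sum A x)"
    by (simp add: exp_sum_def [of A] sum_distrib_left)
  finally show ?thesis .
qed

lemma difference_count_variance:
  assumes A: "A \<subseteq> V" and B: "B \<subseteq> V"
  shows "real (order R) ^ d * (\<Sum>b\<in>V.
      (real (difference_count A B b) - real (card A) * real (card B) / real (order R) ^ d)\<^sup>2) =
    (\<Sum>x\<in>V - {\<zero>\<^sub>v}. (cmod (exp_sum A x))\<^sup>2 * (cmod (exp_sum B x))\<^sup>2)"
proof -
  let ?r = "\<lambda>b. real (difference_count A B b)"
  let ?q = "real (order R) ^ d"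
  have "V \<noteq> {}"
    using vec.M.zero_closed by blast
  have sum_r: "(\<Sum>b\<in>V. ?r b) = real (card A) * real (card B)"
    using sum_difference_count [OF A B] by (simp flip: of_nat_sum of_nat_mult)
  have "?q * (\<Sum>b\<in>V. (?r b - real (card A) * real (card B) / ?q)\<^sup>2) =
      ?q * (\<Sum>b\<in>V. (?r b)\<^sup>2) - (real (card A) * real (card B))\<^sup>2"
    using sum_squared_deviation [OF finite_V \<open>V \<noteq> {}\<close>, of ?r] order_pos
    by (simp add: sum_r card_V right_diff_distrib)
  also have "?q * (\<Sum>b\<in>V. (?r b)\<^sup>2) = (\<Sum>x\<in>V. (cmod (exp_sum A x))\<^sup>2 * (cmod (exp_sum B x))\<^sup>2)"
    using plancherel [of "\<lambda>b. of_nat (difference_count A B b)"]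
    by (simp add: fourier_difference_count [OF A B] norm_mult power_mult_distrib mult.commute)
  also have "\<dots> = (real (card A) * real (card B))\<^sup>2 +
      (\<Sum>x\<in>V - {\<zero>\<^sub>v}. (cmod (exp_sum A x))\<^sup>2 * (cmod (exp_sum B x))\<^sup>2)"
    by (subst sum.remove [of _ "\<zero>\<^sub>v"]) (simp_all add: exp_sum_zero A B power_mult_distrib)
  finally show ?thesis
    by simp
qed

lemma exp_sum_fourth_moment:
  "(\<Sum>x\<in>V - {\<zero>\<^sub>v}. cmod (exp_sum E x) ^ 4) =
    real (order R) ^ d * (real (order R) ^ d * fourier_norm4 R \<chi> d E) ^ 4"
proof -
  let ?q = "real (order R) ^ d"
  let ?m = "(\<Sum>x\<in>V - {\<zero>\<^sub>v}. cmod (fourier_transform R \<chi> d E x) ^ 4) / ?q"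
  have q: "?q > 0"
    using order_pos by simp
  have root4: "(a powr (1/4)) ^ 4 = a" if "0 \<le> a" for a :: real
    using that powr_realpow' [of "a powr (1/4)" 4] by (simp add: powr_powr)
  have "0 \<le> ?m"
    by (intro divide_nonneg_nonneg sum_nonneg) auto
  then have "fourier_norm4 R \<chi> d E ^ 4 = ?m"
    using root4 by (simp only: fourier_norm4_def)
  moreover have "cmod (exp_sum E x) = ?q * cmod (fourier_transform R \<chi> d E x)" for x
    using q by (simp add: fourier_transform_def exp_sum_def norm_divide norm_power)
  ultimately show ?thesis
    using q by (simp add: power_mult_distrib flip: sum_distrib_left)
qed

lemma difference_count_variance_le:
  assumes A: "A \<subseteq> V" and B: "B \<subseteq> V"
  shows
    "(\<Sum>b\<in>V. (real (difference_count A B b) - real (card A) * real (card B) / real (order R) ^ d)\<^sup>2)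
      \<le> ((real (order R) ^ d * fourier_norm4 R \<chi> d A) ^ 4 +
          (real (order R) ^ d * fourier_norm4 R \<chi> d B) ^ 4) / 2" (is "?L \<le> (?a + ?b) / 2")
proof -
  let ?q = "real (order R) ^ d"
  have amgm: "s\<^sup>2 * t\<^sup>2 \<le> s ^ 4 / 2 + t ^ 4 / 2" for s t :: real
    using sum_squares_bound [of "s\<^sup>2" "t\<^sup>2"] by (simp flip: power_mult)
  have "?q * ?L = (\<Sum>x\<in>V - {\<zero>\<^sub>v}. (cmod (exp_sum A x))\<^sup>2 * (cmod (exp_sum B x))\<^sup>2)"
    by (rule difference_count_variance [OF A B])
  also have "\<dots> \<le> (\<Sum>x\<in>V - {\<zero>\<^sub>v}. cmod (exp_sum A x) ^ 4 / 2 + cmod (exp_sum B x) ^ 4 / 2)"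
    by (intro sum_mono amgm)
  also have "\<dots> = ?q * ((?a + ?b) / 2)"
    by (simp add: sum.distrib exp_sum_fourth_moment algebra_simps flip: sum_divide_distrib)
  finally show ?thesis
    using order_pos by simp
qed

lemma fourier_norm4_isometry_image:
  assumes E: "E \<subseteq> V" and g: "g \<in> isometries"
  shows "fourier_norm4 R \<chi> d (g ` E) = fourier_norm4 R \<chi> d E"
proof -
  have inj: "inj_on g E"
    using bij_betw_isometry [OF g] E by (meson bij_betw_def inj_on_subset)
  have transform: "fourier_transform R \<chi> d (g ` E) (g x) = fourier_transform R \<chi> d E x"
    if "x \<in> V" for x
    using that E isometry_dot [OF g]
    by (simp add: fourier_transform_def sum.reindex [OF inj] subset_iff cong: sum.cong)
  have "bij_betw g (V - {\<zero>\<^sub>v}) (V - {\<zero>\<^sub>v})"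
    using bij_betw_DiffI [OF bij_betw_isometry [OF g], of "{\<zero>\<^sub>v}" "{\<zero>\<^sub>v}"] isometry_zero [OF g]
    by (simp add: bij_betw_def)
  then have "(\<Sum>x\<in>V - {\<zero>\<^sub>v}. cmod (fourier_transform R \<chi> d (g ` E) x) ^ 4) =
      (\<Sum>x\<in>V - {\<zero>\<^sub>v}. cmod (fourier_transform R \<chi> d (g ` E) (g x)) ^ 4)"
    by (rule sum.reindex_bij_betw [symmetric])
  also have "\<dots> = (\<Sum>x\<in>V - {\<zero>\<^sub>v}. cmod (fourier_transform R \<chi> d E x) ^ 4)"
    by (simp add: transform)
  finally show ?thesis
    by (simp add: fourier_norm4_def)
qed

lemma difference_count_moment_le:
  assumes E: "E \<subseteq> V" and g: "g \<in> isometries" and k: "1 \<le> k"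
  shows "(\<Sum>b\<in>V. real (difference_count (g ` E) E b) ^ (k + 1)) \<le>
    2 ^ (k + 1) * (real (order R) ^ d * ((real (card E))\<^sup>2 / real (order R) ^ d) ^ (k + 1)) +
    4 * real (card E) ^ (k - 1) * (real (order R) ^ d * fourier_norm4 R \<chi> d E) ^ 4"
proof -
  let ?r = "\<lambda>b. real (difference_count (g ` E) E b)"
  let ?\<mu> = "(real (card E))\<^sup>2 / real (order R) ^ d"
  have gE: "g ` E \<subseteq> V"
    using E isometry_closed [OF g] by blast
  have card_gE: "card (g ` E) = card E"
    using bij_betw_isometry [OF g] E by (meson bij_betw_def card_image inj_on_subset)
  have "(\<Sum>b\<in>V. ?r b ^ (k + 1)) \<le> 2 ^ (k + 1) * (real (card V) * ?\<mu> ^ (k + 1)) +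
      4 * real (card E) ^ (k + 1 - 2) * (\<Sum>b\<in>V. (?r b - ?\<mu>)\<^sup>2)"
    using difference_count_le_card [OF gE] k
    by (intro sum_power_le_deviation [of "k + 1" V ?r "real (card E)" ?\<mu>]) (simp_all add: card_gE)
  also have "(\<Sum>b\<in>V. (?r b - ?\<mu>)\<^sup>2) \<le> (real (order R) ^ d * fourier_norm4 R \<chi> d E) ^ 4"
    using difference_count_variance_le [OF gE E]
    by (simp add: card_gE fourier_norm4_isometry_image [OF E g] power2_eq_square)
  finally show ?thesis
    by (simp add: card_V mult_left_mono)
qed

lemma card_power_le_card_congruence_classes:
  assumes odd: "odd (order R)" and k: "1 \<le> k" "k \<le> d" and E: "E \<subseteq> V"
  shows "real (card E) ^ (2 * (k + 1)) \<le> real (card (congruence_classes R d k E)) *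
    (2 ^ k * real (order R) ^ (k * d - ((k + 1) choose 2)) *
      (2 ^ (k + 1) * (real (order R) ^ d * ((real (card E))\<^sup>2 / real (order R) ^ d) ^ (k + 1)) +
       4 * real (card E) ^ (k - 1) * (real (order R) ^ d * fourier_norm4 R \<chi> d E) ^ 4))"
    (is "_ \<le> ?T * (?B * ?M)")
proof -
  have isometries: "real (card isometries) > 0"
    using one_isometry by (auto simp: card_gt_0_iff)
  have "real (card (congruence k E)) * real (card isometries) \<le>
      ?B * (\<Sum>g\<in>isometries. \<Sum>b\<in>V. real (difference_count (g ` E) E b) ^ (k + 1))"
    using of_nat_mono [OF card_congruence_le [OF odd k(2) E], where 'a = real] by simp
  also have "\<dots> \<le> ?B * (\<Sum>g\<in>isometries. ?M)"
    by (intro mult_left_mono sum_mono difference_count_moment_le [OF E _ k(1)]) auto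
  also have "\<dots> = (?B * ?M) * real (card isometries)"
    by simp
  finally have pairs: "real (card (congruence k E)) \<le> ?B * ?M"
    using isometries by simp
  have "real (card E) ^ (2 * (k + 1)) = (real (card (simplices k E)))\<^sup>2"
    by (simp add: simplices_def card_PiE power2_eq_square mult_2 power_add)
  also have "\<dots> \<le> ?T * real (card (congruence k E))"
    using card_squared_le_card_quotient [OF equiv_congruence [OF E]]
      finite_simplices [OF finite_subset_V [OF E]]
    by (simp add: congruence_classes_def congruence_def)
  also have "\<dots> \<le> ?T * (?B * ?M)"
    using pairs by (rule mult_left_mono) simp
  finally show ?thesis .
qed

end

section \<open>The lower bound\<close>

definition simplex_bound :: "nat \<Rightarrow> nat \<Rightarrow> real \<Rightarrow> real \<Rightarrow> real \<Rightarrow> real" where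
  "simplex_bound d k s q n =
     min (q powr real ((k + 1) choose 2))
       (n powr (real k - 1 + 4 * s) * q powr (real ((k + 1) choose 2) - real k * real d))"

lemma mean_term_eq:
  fixes q n :: real
  assumes q: "0 < q" and m: "m \<le> k * d"
  shows "q ^ (k * d - m) * (q ^ d * (n\<^sup>2 / q ^ d) ^ (k + 1)) = n ^ (2 * (k + 1)) / q powr real m"
proof -
  have "q ^ d * (n\<^sup>2 / q ^ d) ^ (k + 1) = n ^ (2 * (k + 1)) / q ^ (k * d)"
    unfolding power_divide power_mult [symmetric] using q by (simp add: power_add mult.commute)
  moreover have "q ^ (k * d) = q ^ (k * d - m) * q ^ m"
    using m by (simp flip: power_add)
  ultimately show ?thesis
    using q by (simp add: powr_realpow)
qed

lemma deviation_term_eq: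
  fixes q n s :: real
  assumes q: "0 < q" and n: "0 < n" and k: "1 \<le> k" and m: "m \<le> k * d"
  shows "q ^ (k * d - m) * (n ^ (k - 1) * (n powr (1 - s)) ^ 4) =
    n ^ (2 * (k + 1)) / (n powr (real k - 1 + 4 * s) * q powr (real m - real k * real d))"
proof -
  have "n ^ (k - 1) = n powr (real k - 1)"
    using n k by (simp add: of_nat_diff flip: powr_realpow)
  moreover have "(n powr (1 - s)) ^ 4 = n powr (4 * (1 - s))"
    using n by (simp add: powr_powr mult.commute flip: powr_numeral)
  ultimately have "n ^ (k - 1) * (n powr (1 - s)) ^ 4 = n powr (real k - 1 + 4 * (1 - s))"
    by (simp only: powr_add)
  also have "real k - 1 + 4 * (1 - s) = real (2 * (k + 1)) - (real k - 1 + 4 * s)"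
    by (simp add: algebra_simps)
  also have "n powr \<dots> = n ^ (2 * (k + 1)) / n powr (real k - 1 + 4 * s)"
    using n by (simp only: powr_diff powr_realpow)
  finally have "n ^ (k - 1) * (n powr (1 - s)) ^ 4 =
      n ^ (2 * (k + 1)) / n powr (real k - 1 + 4 * s)" .
  moreover have "q ^ (k * d - m) = 1 / q powr (real m - real k * real d)"
    using q m by (simp add: of_nat_diff powr_minus_divide [symmetric] flip: powr_realpow)
  ultimately show ?thesis
    by simp
qed

lemma simplex_bound_le:
  fixes q n T z c s :: real
  assumes q: "0 < q" and n: "0 < n" and T: "0 \<le> T" and k: "1 \<le> k" "k \<le> d"
    and z: "0 \<le> z" "z \<le> c * n powr (1 - s)"
    and bound: "n ^ (2 * (k + 1)) \<le> T * (2 ^ k * q ^ (k * d - ((k + 1) choose 2)) *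
      (2 ^ (k + 1) * (q ^ d * (n\<^sup>2 / q ^ d) ^ (k + 1)) + 4 * n ^ (k - 1) * z ^ 4))"
  shows "simplex_bound d k s q n \<le> 2 ^ k * (2 ^ (k + 1) + 4 * c ^ 4) * T"
proof -
  define m where "m = (k + 1) choose 2"
  define N where "N = n ^ (2 * (k + 1))"
  define a where "a = q powr real m"
  define b where "b = n powr (real k - 1 + 4 * s) * q powr (real m - real k * real d)"
  have m: "m \<le> k * d"
    using sum_diff_Suc_add_choose_two [OF k(2)] by (simp add: m_def)
  have pos: "0 < N" "0 < a" "0 < b"
    using q n by (simp_all add: N_def a_def b_def)
  have "z ^ 4 \<le> c ^ 4 * (n powr (1 - s)) ^ 4"
    using power_mono [OF z(2,1), of 4] by (simp add: power_mult_distrib)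
  then have "N \<le> T * (2 ^ k * q ^ (k * d - m) *
      (2 ^ (k + 1) * (q ^ d * (n\<^sup>2 / q ^ d) ^ (k + 1)) +
       4 * n ^ (k - 1) * (c ^ 4 * (n powr (1 - s)) ^ 4)))"
    using q n T unfolding N_def m_def
    by (intro order_trans [OF bound] mult_left_mono add_left_mono) auto
  also have "\<dots> = 2 ^ k * T * (2 ^ (k + 1) * (q ^ (k * d - m) * (q ^ d * (n\<^sup>2 / q ^ d) ^ (k + 1))) +
      4 * c ^ 4 * (q ^ (k * d - m) * (n ^ (k - 1) * (n powr (1 - s)) ^ 4)))"
    by (simp add: algebra_simps)
  also have "\<dots> = 2 ^ k * T * (2 ^ (k + 1) * (N / a) + 4 * c ^ 4 * (N / b))"
    unfolding mean_term_eq [OF q m] deviation_term_eq [OF q n k(1) m] N_def a_def b_def ..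
  also have "\<dots> = (2 ^ k * T * 2 ^ (k + 1) / a + 2 ^ k * T * (4 * c ^ 4) / b) * N"
    by (simp add: field_simps)
  finally have "1 \<le> 2 ^ k * T * 2 ^ (k + 1) / a + 2 ^ k * T * (4 * c ^ 4) / b"
    using pos by simp
  then have "min a b \<le> 2 ^ k * T * 2 ^ (k + 1) + 2 ^ k * T * (4 * c ^ 4)"
    using pos T by (intro min_le_of_one_le_sum_divide) auto
  then show ?thesis
    by (simp add: simplex_bound_def a_def b_def m_def algebra_simps)
qed

lemma (in finite_field_character) simplex_bound_le_card_congruence_classes:
  assumes odd: "odd (order R)" and k: "1 \<le> k" "k \<le> d" and E: "E \<subseteq> V"
    and salem: "fourier_norm4 R \<chi> d E \<le>
      c * (real (order R) powr (- real d) * real (card E) powr (1 - s))"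
  shows "simplex_bound d k s (real (order R)) (real (card E)) \<le>
    2 ^ k * (2 ^ (k + 1) + 4 * c ^ 4) * real (card (congruence_classes R d k E))"
proof (cases "card E = 0")
  case True
  then have "simplex_bound d k s (real (order R)) (real (card E)) \<le> 0"
    by (simp add: simplex_bound_def)
  also have "0 \<le> 2 ^ k * (2 ^ (k + 1) + 4 * c ^ 4) * real (card (congruence_classes R d k E))"
    by (intro mult_nonneg_nonneg add_nonneg_nonneg) auto
  finally show ?thesis .
next
  case False
  have "real (order R) ^ d * fourier_norm4 R \<chi> d E \<le>
      real (order R) ^ d * (c * (real (order R) powr (- real d) * real (card E) powr (1 - s)))"
    using salem by (rule mult_left_mono) simp
  also have "\<dots> = c * real (card E) powr (1 - s)"
    using order_pos by (simp add: powr_minus powr_realpow)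
  finally show ?thesis
    using False order_pos card_power_le_card_congruence_classes [OF odd k E]
    by (intro simplex_bound_le [where z = "real (order R) ^ d * fourier_norm4 R \<chi> d E"] k)
      (simp_all add: fourier_norm4_def)
qed

lemma powr_le_simplex_bound_half:
  fixes q n c :: real
  assumes q: "0 < q" and c: "0 < c" and n: "q powr (real k * real d / (real k + 1)) \<le> c * n"
  shows "q powr real ((k + 1) choose 2) \<le> (1 + c ^ (k + 1)) * simplex_bound d k (1/2) q n"
proof -
  define a where "a = q powr real ((k + 1) choose 2)"
  define b where "b = n powr (real k + 1) * q powr (real ((k + 1) choose 2) - real k * real d)"
  have "0 < q powr (real k * real d / (real k + 1))"
    using q by simp
  then have "0 < c * n"
    using n by linarith
  then have n_pos: "0 < n"
    using c by (simp add: zero_less_mult_iff)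
  have "q powr (real k * real d) = (q powr (real k * real d / (real k + 1))) powr (real k + 1)"
    by (simp add: powr_powr)
  also have "\<dots> \<le> (c * n) powr (real k + 1)"
    using n by (intro powr_mono2) auto
  also have "\<dots> = c ^ (k + 1) * n powr (real k + 1)"
    using c n_pos powr_realpow [OF c, of "k + 1"] by (simp add: powr_mult add.commute)
  finally have "q powr (real k * real d) * q powr (real ((k + 1) choose 2) - real k * real d) \<le>
      c ^ (k + 1) * b"
    unfolding b_def mult.assoc [symmetric] by (rule mult_right_mono) simp
  then have "a \<le> c ^ (k + 1) * b"
    by (simp add: a_def flip: powr_add)
  moreover have "0 \<le> a" "0 \<le> b" "0 \<le> c ^ (k + 1)"
    using c by (simp_all add: a_def b_def)
  ultimately have "a \<le> (1 + c ^ (k + 1)) * min a b"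
    by (simp add: min_def distrib_right add_increasing)
  then show ?thesis
    by (simp add: simplex_bound_def a_def b_def add.commute)
qed

lemma lesssim_trans: "lesssim I f g \<Longrightarrow> lesssim I g h \<Longrightarrow> lesssim I f h"
  unfolding lesssim_def
proof (elim exE conjE)
  fix c c' :: real
  assume c: "0 < c" "\<forall>i\<in>I. f i \<le> c * g i" and c': "0 < c'" "\<forall>i\<in>I. g i \<le> c' * h i"
  have "f i \<le> c * c' * h i" if "i \<in> I" for i
  proof -
    have "f i \<le> c * g i"
      using c(2) that by blast
    also have "\<dots> \<le> c * (c' * h i)"
      using c(1) c'(2) that by (intro mult_left_mono) auto
    finally show ?thesis
      by (simp only: mult.assoc)
  qed
  then show "\<exists>c>0. \<forall>i\<in>I. f i \<le> c * h i"
    using c c' by (intro exI [of _ "c * c'"]) simp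
qed

lemma salem4_imp_lesssim_congruence_classes:
  assumes k: "1 \<le> k" "k \<le> d"
    and F: "\<And>i. i \<in> I \<Longrightarrow> finite_field_character (F i) (\<chi> i)"
    and odd: "\<And>i. i \<in> I \<Longrightarrow> odd (order (F i))"
    and E: "\<And>i. i \<in> I \<Longrightarrow> E i \<subseteq> vectors (F i) d"
    and salem: "salem4 I F \<chi> d s E"
  shows "lesssim I (\<lambda>i. simplex_bound d k s (real (order (F i))) (real (card (E i))))
    (\<lambda>i. real (card (congruence_classes (F i) d k (E i))))"
proof -
  obtain c where c: "0 < c" "\<And>i. i \<in> I \<Longrightarrow> fourier_norm4 (F i) (\<chi> i) d (E i) \<le>
      c * (real (order (F i)) powr (- real d) * real (card (E i)) powr (1 - s))"
    using salem unfolding salem4_def lesssim_def by blast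
  have "0 < 2 ^ k * (2 ^ (k + 1) + 4 * c ^ 4)"
    using c(1) by (intro mult_pos_pos add_pos_pos) auto
  then show ?thesis
    unfolding lesssim_def
    using finite_field_character.simplex_bound_le_card_congruence_classes [OF F odd k E c(2)]
    by blast
qed

lemma lesssim_simplex_bound_half:
  assumes "\<And>i. i \<in> I \<Longrightarrow> 0 < q i"
    and "lesssim I (\<lambda>i. q i powr (real k * real d / (real k + 1))) n"
  shows "lesssim I (\<lambda>i. q i powr real ((k + 1) choose 2)) (\<lambda>i. simplex_bound d k (1/2) (q i) (n i))"
proof -
  obtain c where c: "0 < c" "\<And>i. i \<in> I \<Longrightarrow> q i powr (real k * real d / (real k + 1)) \<le> c * n i"
    using assms(2) unfolding lesssim_def by blast
  then have "0 < 1 + c ^ (k + 1)"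
    by (intro add_pos_pos) auto
  then show ?thesis
    unfolding lesssim_def using powr_le_simplex_bound_half [OF assms(1) c] by blast
qed

theorem theorem9p7:
  fixes I :: "'i set"
    and F :: "'i \<Rightarrow> 'a ring"
    and \<chi> :: "'i \<Rightarrow> 'a \<Rightarrow> complex"
    and E :: "'i \<Rightarrow> (nat \<Rightarrow> 'a) set"
    and d k :: nat
  assumes "1 \<le> k" and "k \<le> d"
    and "\<And>i. i \<in> I \<Longrightarrow> field (F i)"
    and "\<And>i. i \<in> I \<Longrightarrow> finite (carrier (F i))"
    and "\<And>i. i \<in> I \<Longrightarrow> odd (order (F i))"
    and "\<And>i. i \<in> I \<Longrightarrow> nontrivial_additive_character (F i) (\<chi> i)"
    and "\<And>i. i \<in> I \<Longrightarrow> E i \<subseteq> vectors (F i) d"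
  shows
    "(\<forall>s. salem4 I F \<chi> d s E \<longrightarrow>
        lesssim I
          (\<lambda>i. min (real (order (F i)) powr real ((k + 1) choose 2))
                   (real (card (E i)) powr (real k - 1 + 4 * s) *
                    real (order (F i)) powr (real ((k + 1) choose 2) - real k * real d)))
          (\<lambda>i. real (card (congruence_classes (F i) d k (E i)))))
     \<and>
     (lesssim I (\<lambda>i. real (order (F i)) powr (real k * real d / (real k + 1)))
                (\<lambda>i. real (card (E i))) \<and>
      salem4 I F \<chi> d (1/2) E \<longrightarrow>
        lesssim I (\<lambda>i. real (order (F i)) powr real ((k + 1) choose 2))
                  (\<lambda>i. real (card (congruence_classes (F i) d k (E i)))))"
proof -
  have space: "finite_field_character (F i) (\<chi> i)" if "i \<in> I" for i
    using assms(3,4,6) [OF that] field.axioms(1) domain.axioms(1)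
    by (auto simp: finite_field_character_def finite_field_character_axioms_def
        finite_field_space_def finite_coordinate_space_def finite_coordinate_space_axioms_def)
  have order: "0 < real (order (F i))" if "i \<in> I" for i
    using odd_pos [OF assms(5) [OF that]] by simp
  have lower_bound: "lesssim I (\<lambda>i. simplex_bound d k s (real (order (F i))) (real (card (E i))))
      (\<lambda>i. real (card (congruence_classes (F i) d k (E i))))" if "salem4 I F \<chi> d s E" for s
    by (rule salem4_imp_lesssim_congruence_classes [OF assms(1,2) space assms(5,7) that])
  show ?thesis
    using lower_bound lesssim_trans [OF lesssim_simplex_bound_half [OF order] lower_bound]
    unfolding simplex_bound_def by blast
qed

end
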